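(* Let $f\colon\mathbb{F}_2^n\to\mathbb{F}_2$ be a polynomial of degree $d\le\log(n)/3$, given as a black box (oracle). Then there exists an algorithm that makes $\mathrm{poly}(n)$ queries to $f$, runs in time $\mathrm{poly}(n)$, and finds an affine subspace $U$ of dimension $\Omega(d\cdot n^{1/(d-1)})$ such that $\deg(f|_U)\le d-1$.
   Context: For an affine subspace $U\subseteq\mathbb{F}_2^n$, $\deg(f|_U)$ is the minimal degree of a polynomial $\mathbb{F}_2^n\to\mathbb{F}_2$ agreeing with $f$ on $U$. Logarithms are to base 2. *)

theory Defs
  imports Complex_Main "HOL-Library.Z2" "HOL-Library.Function_Algebras"
begin

subsection \<open>The vector spaces \<open>F\<^sub>2\<^sup>n\<close>\<close>

text \<open>Since a single algorithm has to work for all \<open>n\<close> at once, the spaces \<open>F\<^sub>2\<^sup>n\<close> are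
  realised uniformly as the subspaces \<open>F2 n\<close> of the space of all functions \<open>nat \<Rightarrow> bit\<close>;
  coordinates are numbered from \<open>0\<close> to \<open>n - 1\<close>.\<close>

type_synonym point = "nat \<Rightarrow> bit"

definition scale2 :: "bit \<Rightarrow> point \<Rightarrow> point" where
  "scale2 a v = (\<lambda>i. a * v i)"

global_interpretation F2: vector_space scale2
  by unfold_locales (auto simp: scale2_def fun_eq_iff algebra_simps)

definition F2 :: "nat \<Rightarrow> point set" where
  "F2 n = {x. \<forall>i\<ge>n. x i = 0}"

definition affine_subspace :: "nat \<Rightarrow> nat \<Rightarrow> point set \<Rightarrow> bool" where
  "affine_subspace n k U \<longleftrightarrow>
    (\<exists>a\<in>F2 n. \<exists>V\<subseteq>F2 n. F2.subspace V \<and> F2.dim V = k \<and> U = (\<lambda>v. a + v) ` V)"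


subsection \<open>Polynomials over \<open>F\<^sub>2\<close>\<close>

text \<open>As \<open>x\<^sup>2 = x\<close> on \<open>F\<^sub>2\<close>, polynomials are taken multilinear: \<open>p S\<close> is the coefficient of the
  monomial \<open>\<Prod>i\<in>S. x i\<close>, for \<open>S \<subseteq> {..<n}\<close>. The zero polynomial gets degree \<open>0\<close>.\<close>

type_synonym mlpoly = "nat set \<Rightarrow> bit"

definition mleval :: "nat \<Rightarrow> mlpoly \<Rightarrow> point \<Rightarrow> bit" where
  "mleval n p x = (\<Sum>S\<in>Pow {..<n}. p S * (\<Prod>i\<in>S. x i))"

definition mldegree :: "nat \<Rightarrow> mlpoly \<Rightarrow> nat" where
  "mldegree n p = Max (insert 0 (card ` {S. S \<subseteq> {..<n} \<and> p S \<noteq> 0}))"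

definition degree_on :: "nat \<Rightarrow> point set \<Rightarrow> (point \<Rightarrow> bit) \<Rightarrow> nat" where
  "degree_on n U f = (LEAST k. \<exists>p. mldegree n p = k \<and> (\<forall>x\<in>U. mleval n p x = f x))"


subsection \<open>Oracle algorithms\<close>

text \<open>Algorithms are programs for a structured random access machine with finitely many named
  arrays of natural numbers (a scalar variable is cell \<open>0\<close> of an array). The only arithmetic is
  addition and truncated subtraction. Hence a run of \<open>t\<close> steps only produces numbers of bit length
  \<open>O(t)\<close> plus the bit length of the input, so that the unit-cost measure below is polynomially
  related to Turing machine time; this would fail with a unit-cost multiplication.\<close>

type_synonym vname = string
type_synonym state = "vname \<Rightarrow> nat \<Rightarrow> nat"

datatype expr =
    Const nat
  | Cell vname expr
  | Add expr expr
  | Sub expr expr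

primrec val :: "expr \<Rightarrow> state \<Rightarrow> nat" where
  "val (Const k) s = k"
| "val (Cell x e) s = s x (val e s)"
| "val (Add e1 e2) s = val e1 s + val e2 s"
| "val (Sub e1 e2) s = val e1 s - val e2 s"

primrec cost :: "expr \<Rightarrow> nat" where
  "cost (Const k) = 1"
| "cost (Cell x e) = 1 + cost e"
| "cost (Add e1 e2) = 1 + cost e1 + cost e2"
| "cost (Sub e1 e2) = 1 + cost e1 + cost e2"

text \<open>\<open>Assign x i e\<close> is \<open>x[i] := e\<close>; \<open>Query x i y\<close> is \<open>x[i] := f(y[0],\<dots>,y[n-1])\<close> for
  the oracle \<open>f\<close>. Guards are true when nonzero.\<close>

datatype prog =
    Skip
  | Assign vname expr expr
  | Query vname expr vname
  | Seq prog prog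
  | If expr prog prog
  | While expr prog

definition put :: "state \<Rightarrow> vname \<Rightarrow> nat \<Rightarrow> nat \<Rightarrow> state" where
  "put s x i k = s(x := (s x)(i := k))"

text \<open>The first \<open>n\<close> cells of an array as a vector, \<open>of_nat\<close> being reduction modulo \<open>2\<close>.\<close>

definition read_point :: "nat \<Rightarrow> (nat \<Rightarrow> nat) \<Rightarrow> point" where
  "read_point n a = (\<lambda>j. if j < n then of_nat (a j) else 0)"

text \<open>\<open>run n f P s q t s'\<close>: with oracle \<open>f\<close> on \<open>F2 n\<close>, the program \<open>P\<close> started in \<open>s\<close>
  terminates in \<open>s'\<close> after \<open>q\<close> queries and time \<open>t\<close>. A query takes time at least \<open>n\<close>, the length
  of its argument.\<close>

inductive run :: "nat \<Rightarrow> (point \<Rightarrow> bit) \<Rightarrow> prog \<Rightarrow> state \<Rightarrow> nat \<Rightarrow> nat \<Rightarrow> state \<Rightarrow> bool"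
  for n :: nat and f :: "point \<Rightarrow> bit" where
  Skip: "run n f Skip s 0 1 s"
| Assign: "run n f (Assign x i e) s 0 (1 + cost i + cost e) (put s x (val i s) (val e s))"
| Query: "run n f (Query x i y) s 1 (1 + n + cost i)
           (put s x (val i s) (of_bool (f (read_point n (s y)) = 1)))"
| Seq: "\<lbrakk>run n f P s q t s'; run n f Q s' q' t' s''\<rbrakk>
         \<Longrightarrow> run n f (Seq P Q) s (q + q') (t + t') s''"
| IfTrue: "\<lbrakk>val e s \<noteq> 0; run n f P s q t s'\<rbrakk> \<Longrightarrow> run n f (If e P Q) s q (1 + cost e + t) s'"
| IfFalse: "\<lbrakk>val e s = 0; run n f Q s q t s'\<rbrakk> \<Longrightarrow> run n f (If e P Q) s q (1 + cost e + t) s'"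
| WhileFalse: "val e s = 0 \<Longrightarrow> run n f (While e P) s 0 (1 + cost e) s"
| WhileTrue: "\<lbrakk>val e s \<noteq> 0; run n f P s q t s'; run n f (While e P) s' q' t' s''\<rbrakk>
         \<Longrightarrow> run n f (While e P) s (q + q') (1 + cost e + t + t') s''"

inductive_cases run_SkipE: "run n f Skip s q t s'"
inductive_cases run_AssignE: "run n f (Assign x i e) s q t s'"
inductive_cases run_QueryE: "run n f (Query x i y) s q t s'"
inductive_cases run_SeqE: "run n f (Seq P Q) s q t s'"
inductive_cases run_IfE: "run n f (If e P Q) s q t s'"
inductive_cases run_WhileE: "run n f (While e P) s q t s'"

lemma run_deterministic:
  "run n f P s q t s' \<Longrightarrow> run n f P s q' t' s'' \<Longrightarrow> q' = q \<and> t' = t \<and> s'' = s'"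
proof (induction arbitrary: q' t' s'' rule: run.induct)
  case (Skip s)
  from Skip.prems show ?case by (elim run_SkipE) simp
next
  case (Assign x i e s)
  from Assign.prems show ?case by (elim run_AssignE) simp
next
  case (Query x i y s)
  from Query.prems show ?case by (elim run_QueryE) simp
next
  case (Seq P s q1 t1 s1 Q q2 t2 s2)
  from Seq.prems obtain q3 t3 s3 q4 t4 where
    1: "run n f P s q3 t3 s3" and 2: "run n f Q s3 q4 t4 s''"
    and eq: "q' = q3 + q4" "t' = t3 + t4"
    by (elim run_SeqE) blast
  from Seq.IH(1)[OF 1] have 3: "q3 = q1" "t3 = t1" "s3 = s1" by blast+
  from Seq.IH(2)[OF 2[unfolded 3]] have "q4 = q2" "t4 = t2" "s'' = s2" by blast+
  with 3 eq show ?case by blast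
next
  case (IfTrue e s P q1 t1 s1 Q)
  from IfTrue.prems IfTrue.hyps(1)
  obtain t3 where 1: "run n f P s q' t3 s''" and eq: "t' = 1 + cost e + t3"
    by (elim run_IfE) simp_all
  from IfTrue.IH[OF 1] eq show ?case by blast
next
  case (IfFalse e s Q q1 t1 s1 P)
  from IfFalse.prems IfFalse.hyps(1)
  obtain t3 where 1: "run n f Q s q' t3 s''" and eq: "t' = 1 + cost e + t3"
    by (elim run_IfE) simp_all
  from IfFalse.IH[OF 1] eq show ?case by blast
next
  case (WhileFalse e s P)
  from WhileFalse.prems WhileFalse.hyps show ?case by (cases rule: run_WhileE) auto
next
  case (WhileTrue e s P q1 t1 s1 q2 t2 s2)
  from WhileTrue.prems WhileTrue.hyps(1)
  obtain q3 t3 s3 q4 t4 where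
    1: "run n f P s q3 t3 s3" and 2: "run n f (While e P) s3 q4 t4 s''"
    and eq: "q' = q3 + q4" "t' = 1 + cost e + t3 + t4"
    by (cases rule: run_WhileE) auto
  from WhileTrue.IH(1)[OF 1] have 3: "q3 = q1" "t3 = t1" "s3 = s1" by blast+
  from WhileTrue.IH(2)[OF 2[unfolded 3]] have "q4 = q2" "t4 = t2" "s'' = s2" by blast+
  with 3 eq show ?case by blast
qed

definition input_state :: "nat \<Rightarrow> nat \<Rightarrow> state" where
  "input_state n d = put (put (\<lambda>x i. 0) ''n'' 0 n) ''d'' 0 d"

text \<open>The output is read from the array \<open>out\<close>: cell \<open>0\<close> holds a number \<open>m\<close>, followed by
  \<open>m + 1\<close> blocks of \<open>n\<close> cells, namely a base point and \<open>m\<close> vectors spanning the direction space.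
  These vectors need not be independent; the dimension is that of their span.\<close>

definition out_block :: "nat \<Rightarrow> state \<Rightarrow> nat \<Rightarrow> point" where
  "out_block n s b = read_point n (\<lambda>j. s ''out'' (1 + b * n + j))"

definition output_subspace :: "nat \<Rightarrow> state \<Rightarrow> point set" where
  "output_subspace n s =
    (\<lambda>v. out_block n s 0 + v) ` F2.span (out_block n s ` {1..s ''out'' 0})"

end

(*
  Writing D_w f(x) = f(x) + f(x + w), a function f of degree at most d restricted to the span of
  v_1, ..., v_k has degree at most d - 1 iff D_{v_i : i in S} f = 0 for all S of size d.
  The directions are chosen greedily. Since (d+1)-fold derivatives of f vanish, for a set T of d - 1
  indices b |-> D_{v_i : i in T} D_b f(0) is a linear functional, computed by 2^d queries. The
  algorithm keeps a list of candidates, linearly independent together with v_1, ..., v_k, on which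
  all these functionals vanish. It moves a candidate to the v's, and then, for every new T, makes the
  candidates satisfy the new equation by one pivoting step, which loses at most one of them. As long
  as the number L of sets T of size at most d - 1 satisfies 2 L <= n, candidates are left; and when
  this fails, the count L <= (e k / (d - 1))^(d - 1) forces k to be large.
*)

theory Submission
  imports Defs "HOL-Library.Multiset"
begin

section \<open>Total correctness with running times\<close>

text \<open>Only \<open>card S = d\<close> matters because the derivative at \<open>0\<close> along
  the \<open>v i\<close> with \<open>i\<close> in \<open>S\<close> is the coefficient of
  \<open>f\<close> at the monomial \<open>S\<close> in the coordinates of the span, and it vanishes
  by degree when \<open>card S > d\<close>. Linear forms dual to the \<open>v i\<close> turn this
  expansion into a polynomial on the whole space; this is one use of linear independence, the other
  being that the span has dimension \<open>k\<close>.

  The functional of \<open>T\<close> is additive in \<open>b\<close> because its defect for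
  \<open>b\<close>, \<open>c\<close> is a \<open>(d - 1)\<close>-fold derivative of a second
  derivative of \<open>f\<close>. Additivity also lets old equations survive later pivoting, so only
  new sets need treatment.

  The obstacle is to keep candidates available. If there are \<open>m\<close> of them, a round
  creating \<open>r\<close> sets lowers \<open>m\<close> by at most \<open>1 + r\<close> and raises
  \<open>2 L\<close> by \<open>2 r\<close>; as \<open>r \<ge> 1\<close>, the potential
  \<open>m + 2 L\<close> never falls below its initial value \<open>n + 2\<close>. A round at most
  doubles \<open>L\<close>, so the guard \<open>2 L \<le> n\<close> keeps all tables within
  \<open>n\<close> rows. The bound on \<open>d\<close> ensures \<open>d - 1 \<le> k\<close> at the
  end, where the estimate of \<open>L\<close> applies.\<close>

primrec writes :: "prog \<Rightarrow> vname set" where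
  "writes Skip = {}"
| "writes (Assign x i e) = {x}"
| "writes (Query x i y) = {x}"
| "writes (Seq P Q) = writes P \<union> writes Q"
| "writes (If e P Q) = writes P \<union> writes Q"
| "writes (While e P) = writes P"

lemma run_frame: "run n f P s q t s' \<Longrightarrow> x \<notin> writes P \<Longrightarrow> s' x = s x"
  by (induction rule: run.induct) (auto simp: put_def)

lemma run_queries_le_time: "run n f P s q t s' \<Longrightarrow> q \<le> t"
  by (induction rule: run.induct) auto

text \<open>Total correctness with a time budget. The query count stays existential, since
  \<open>run_queries_le_time\<close> bounds it by the time.\<close>

definition halts :: "nat \<Rightarrow> (point \<Rightarrow> bit) \<Rightarrow> prog \<Rightarrow> state \<Rightarrow> nat \<Rightarrow> (state \<Rightarrow> bool) \<Rightarrow> bool" where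
  "halts n f P s t Q \<longleftrightarrow> (\<exists>q t' s'. run n f P s q t' s' \<and> t' \<le> t \<and> Q s')"

text \<open>The frame facts handed to the last premise allow postconditions to mention only the
  arrays that \<open>P\<close> changes; \<open>halts_Seq\<close> passes them on in the same
  way.\<close>

lemma halts_weaken:
  assumes "halts n f P s t Q" "t \<le> t'"
    and "\<And>s'. Q s' \<Longrightarrow> (\<And>y. y \<notin> writes P \<Longrightarrow> s' y = s y) \<Longrightarrow> Q' s'"
  shows "halts n f P s t' Q'"
proof -
  obtain q t0 s' where r: "run n f P s q t0 s'" "t0 \<le> t" "Q s'"
    using assms(1) by (auto simp: halts_def)
  have "Q' s'" using r(3) run_frame[OF r(1)] by (rule assms(3))
  with r assms(2) show ?thesis unfolding halts_def by (meson le_trans)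
qed

lemma halts_Skip: "Q s \<Longrightarrow> halts n f Skip s 1 Q"
  unfolding halts_def by (blast intro: run.Skip)

lemma halts_Assign:
  "Q (put s x (val i s) (val e s)) \<Longrightarrow> halts n f (Assign x i e) s (1 + cost i + cost e) Q"
  unfolding halts_def by (blast intro: run.Assign)

lemma halts_Query:
  "Q (put s x (val i s) (of_bool (f (read_point n (s y)) = 1)))
    \<Longrightarrow> halts n f (Query x i y) s (1 + n + cost i) Q"
  unfolding halts_def by (blast intro: run.Query)

lemma halts_Seq:
  assumes "halts n f P s t R"
    and "\<And>s'. R s' \<Longrightarrow> (\<And>y. y \<notin> writes P \<Longrightarrow> s' y = s y) \<Longrightarrow> halts n f P' s' t' Q"
  shows "halts n f (Seq P P') s (t + t') Q"
proof -
  obtain q t1 s' where r: "run n f P s q t1 s'" "t1 \<le> t" "R s'"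
    using assms(1) by (auto simp: halts_def)
  obtain q' t2 s'' where r': "run n f P' s' q' t2 s''" "t2 \<le> t'" "Q s''"
    using assms(2)[OF r(3) run_frame[OF r(1)]] by (auto simp: halts_def)
  show ?thesis unfolding halts_def
    using run.Seq[OF r(1) r'(1)] r r' add_mono by blast
qed

lemma halts_Assign_Seq:
  "halts n f P (put s x (val i s) (val e s)) t Q
    \<Longrightarrow> halts n f (Seq (Assign x i e) P) s (1 + cost i + cost e + t) Q"
  by (rule halts_Seq[OF halts_Assign[where Q = "\<lambda>s'. s' = put s x (val i s) (val e s)"]]) auto

lemma halts_If:
  assumes "val e s \<noteq> 0 \<Longrightarrow> halts n f P s t Q" "val e s = 0 \<Longrightarrow> halts n f P' s t' Q"
  shows "halts n f (If e P P') s (1 + cost e + max t t') Q"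
proof (cases "val e s = 0")
  case True
  then obtain q t1 s' where r: "run n f P' s q t1 s'" "t1 \<le> t'" "Q s'"
    using assms(2) by (auto simp: halts_def)
  have "1 + cost e + t1 \<le> 1 + cost e + max t t'" using r by simp
  with run.IfFalse[OF True r(1)] r(3) show ?thesis unfolding halts_def by blast
next
  case False
  then obtain q t1 s' where r: "run n f P s q t1 s'" "t1 \<le> t" "Q s'"
    using assms(1) by (auto simp: halts_def)
  have "1 + cost e + t1 \<le> 1 + cost e + max t t'" using r by simp
  with run.IfTrue[OF False r(1)] r(3) show ?thesis unfolding halts_def by blast
qed

text \<open>With a body budget uniform over all iterations, there are at most \<open>\<mu> s\<close>
  body runs and one more guard test.\<close>

lemma halts_While:
  fixes \<mu> :: "state \<Rightarrow> nat"
  assumes "I s"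
    and step: "\<And>s. I s \<Longrightarrow> val e s \<noteq> 0 \<Longrightarrow> halts n f P s t (\<lambda>s'. I s' \<and> \<mu> s' < \<mu> s)"
  shows "halts n f (While e P) s ((\<mu> s + 1) * (1 + cost e + t)) (\<lambda>s'. I s' \<and> val e s' = 0)"
  using \<open>I s\<close>
proof (induction "\<mu> s" arbitrary: s rule: less_induct)
  case less
  show ?case
  proof (cases "val e s = 0")
    case True
    have "1 + cost e \<le> (\<mu> s + 1) * (1 + cost e + t)" by simp
    with run.WhileFalse[OF True] True less.prems show ?thesis
      unfolding halts_def by blast
  next
    case False
    obtain q t1 s' where r: "run n f P s q t1 s'" "t1 \<le> t" "I s'" "\<mu> s' < \<mu> s"
      using step[OF less.prems False] by (auto simp: halts_def)
    obtain q' t2 s'' where r': "run n f (While e P) s' q' t2 s''"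
      "t2 \<le> (\<mu> s' + 1) * (1 + cost e + t)" "I s''" "val e s'' = 0"
      using less.hyps[OF r(4,3)] by (auto simp: halts_def)
    have "1 + cost e + t1 + t2 \<le> (1 + cost e + t) + (\<mu> s' + 1) * (1 + cost e + t)"
      using r r' by simp
    also have "\<dots> = (\<mu> s' + 2) * (1 + cost e + t)" by simp
    also have "\<dots> \<le> (\<mu> s + 1) * (1 + cost e + t)" using r(4) by (intro mult_right_mono) auto
    finally show ?thesis
      using run.WhileTrue[OF False r(1) r'(1)] r' unfolding halts_def by blast
  qed
qed

abbreviation Var :: "vname \<Rightarrow> expr" where
  "Var x \<equiv> Cell x (Const 0)"

abbreviation Set :: "vname \<Rightarrow> expr \<Rightarrow> prog" where
  "Set x e \<equiv> Assign x (Const 0) e"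

lemma halts_Assign_Seq_eval:
  "val i s = a \<Longrightarrow> val e s = b \<Longrightarrow> halts n f P (put s x a b) t Q
    \<Longrightarrow> halts n f (Seq (Assign x i e) P) s (1 + cost i + cost e + t) Q"
  using halts_Assign_Seq by blast

definition For :: "vname \<Rightarrow> expr \<Rightarrow> prog \<Rightarrow> prog" where
  "For x e P = Seq (Set x (Const 0))
     (While (Sub e (Var x)) (Seq P (Set x (Add (Var x) (Const 1)))))"

lemma writes_For [simp]: "writes (For x e P) = insert x (writes P)"
  by (auto simp: For_def)

text \<open>The invariant is indexed by the counter. \<open>Ix\<close> makes it insensitive to the
  counter cell, which is incremented only after the body. The \<open>15\<close> absorbs
  initialisation, guard and increment.\<close>

lemma halts_For:
  assumes x: "x \<notin> writes P"
    and e: "\<And>s'. (\<And>y. y \<notin> insert x (writes P) \<Longrightarrow> s' y = s y) \<Longrightarrow> val e s' = N"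
    and I0: "\<And>s'. (\<And>y. y \<noteq> x \<Longrightarrow> s' y = s y) \<Longrightarrow> I 0 s'"
    and Ix: "\<And>i s k. I i s \<Longrightarrow> I i (put s x 0 k)"
    and body: "\<And>i s'. i < N \<Longrightarrow> s' x 0 = i \<Longrightarrow> I i s'
      \<Longrightarrow> (\<And>y. y \<notin> insert x (writes P) \<Longrightarrow> s' y = s y) \<Longrightarrow> halts n f P s' t (I (Suc i))"
  shows "halts n f (For x e P) s ((N + 1) * (t + cost e + 15)) (I N)"
proof -
  define Q where "Q = (\<lambda>s'. s' x 0 \<le> N \<and> I (s' x 0) s'
      \<and> (\<forall>y. y \<notin> insert x (writes P) \<longrightarrow> s' y = s y))"
  have val: "val e s' = N" if "Q s'" for s'
    using that e unfolding Q_def by blast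
  let ?s = "put s x 0 0"
  let ?P = "Seq P (Set x (Add (Var x) (Const 1)))"
  have "halts n f (While (Sub e (Var x)) ?P) ?s
    ((N - ?s x 0 + 1) * (1 + cost (Sub e (Var x)) + (t + 6))) (\<lambda>s'. Q s' \<and> val (Sub e (Var x)) s' = 0)"
  proof (rule halts_While[where \<mu> = "\<lambda>s'. N - s' x 0"])
    show "Q ?s" unfolding Q_def by (auto simp: put_def intro!: I0)
    fix s' assume Q: "Q s'" and nz: "val (Sub e (Var x)) s' \<noteq> 0"
    from nz have lt: "s' x 0 < N" using val[OF Q] by simp
    have "halts n f ?P s' (t + (1 + cost (Const 0) + cost (Add (Var x) (Const 1))))
      (\<lambda>s''. Q s'' \<and> N - s'' x 0 < N - s' x 0)"
    proof (rule halts_Seq)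
      show "halts n f P s' t (I (Suc (s' x 0)))"
        using Q lt by (intro body) (auto simp: Q_def)
      fix s'' assume I: "I (Suc (s' x 0)) s''" and fr: "\<And>y. y \<notin> writes P \<Longrightarrow> s'' y = s' y"
      have "s'' x = s' x" using x by (rule fr)
      then have "Q (put s'' x 0 (Suc (s'' x 0)))"
        using Q lt Ix[OF I, of "Suc (s'' x 0)"] fr by (auto simp: Q_def put_def)
      with \<open>s'' x = s' x\<close> lt
      show "halts n f (Set x (Add (Var x) (Const 1))) s'' (1 + cost (Const 0) + cost (Add (Var x) (Const 1)))
        (\<lambda>s''. Q s'' \<and> N - s'' x 0 < N - s' x 0)"
        by (intro halts_Assign) (auto simp: put_def)
    qed
    then show "halts n f ?P s' (t + 6) (\<lambda>s''. Q s'' \<and> N - s'' x 0 < N - s' x 0)"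
      by (rule halts_weaken) auto
  qed
  then have "halts n f (For x e P) s (1 + cost (Const 0) + cost (Const 0) +
      (N - ?s x 0 + 1) * (1 + cost (Sub e (Var x)) + (t + 6))) (\<lambda>s'. Q s' \<and> val (Sub e (Var x)) s' = 0)"
    unfolding For_def by (intro halts_Assign_Seq) auto
  then show ?thesis
  proof (rule halts_weaken)
    fix s' assume "Q s' \<and> val (Sub e (Var x)) s' = 0"
    then show "I N s'" using val[of s'] by (auto simp: Q_def dest: le_antisym)
  qed (simp add: put_def algebra_simps)
qed

definition Fill :: "vname \<Rightarrow> expr \<Rightarrow> expr \<Rightarrow> prog" where
  "Fill x a e = For ''j'' (Var ''n'') (Assign x (Add a (Var ''j'')) e)"

lemma writes_Fill [simp]: "writes (Fill x a e) = {''j'', x}"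
  by (auto simp: Fill_def)

text \<open>Premise \<open>e\<close> grants old values only for the cells of \<open>x\<close> not
  yet overwritten. Thus \<open>e\<close> may read the array being filled, as in-place elimination
  and the update of \<open>y\<close> do.\<close>

lemma halts_Fill:
  assumes x: "x \<noteq> ''j''" "x \<noteq> ''n''" and n: "s ''n'' 0 = n"
    and a: "\<And>s'. (\<And>y. y \<notin> {''j'', x} \<Longrightarrow> s' y = s y) \<Longrightarrow> val a s' = base"
    and e: "\<And>s' j. j < n \<Longrightarrow> s' ''j'' 0 = j \<Longrightarrow> (\<And>i. i \<notin> {base..<base + j} \<Longrightarrow> s' x i = s x i)
      \<Longrightarrow> (\<And>y. y \<notin> {''j'', x} \<Longrightarrow> s' y = s y) \<Longrightarrow> val e s' = g j"
  shows "halts n f (Fill x a e) s ((n + 1) * (cost a + cost e + 25))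
    (\<lambda>s'. (\<forall>j<n. s' x (base + j) = g j) \<and> (\<forall>i. i \<notin> {base..<base + n} \<longrightarrow> s' x i = s x i))"
proof -
  let ?I = "\<lambda>k s'. (\<forall>j<k. s' x (base + j) = g j) \<and> (\<forall>i. i \<notin> {base..<base + k} \<longrightarrow> s' x i = s x i)"
  have "halts n f (Fill x a e) s
    ((n + 1) * ((1 + cost (Add a (Var ''j'')) + cost e) + cost (Var ''n'') + 15)) (?I n)"
    unfolding Fill_def
  proof (rule halts_For)
    show "''j'' \<notin> writes (Assign x (Add a (Var ''j'')) e)" using x by simp
    show "val (Var ''n'') s' = n"
      if "\<And>y. y \<notin> insert ''j'' (writes (Assign x (Add a (Var ''j'')) e)) \<Longrightarrow> s' y = s y" for s'
      using that[of "''n''"] x n by simp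
    show "?I i (put s ''j'' 0 k)" if "?I i s" for i s k
      using that x by (auto simp: put_def)
    show "?I 0 s'" if "\<And>y. y \<noteq> ''j'' \<Longrightarrow> s' y = s y" for s'
      using that x by simp
    fix i s' assume i: "i < n" "s' ''j'' 0 = i" and I: "?I i s'"
      and fr: "\<And>y. y \<notin> insert ''j'' (writes (Assign x (Add a (Var ''j'')) e)) \<Longrightarrow> s' y = s y"
    have "val a s' = base" using fr by (intro a) auto
    moreover have "val e s' = g i" using fr i I by (intro e) auto
    ultimately show "halts n f (Assign x (Add a (Var ''j'')) e) s'
        (1 + cost (Add a (Var ''j'')) + cost e) (?I (Suc i))"
      using i I by (intro halts_Assign) (auto simp: put_def less_Suc_eq)
  qed
  then show ?thesis by (rule halts_weaken) (auto simp: add_mult_distrib2)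
qed

section \<open>The program\<close>

text \<open>A matrix with rows of length \<open>n\<close> is stored row by row, and \<open>u[t] = t n\<close> is a lookup table
  for the start of row \<open>t\<close>, since the machine cannot multiply. The rows of \<open>b\<close> are the \<open>m\<close> remaining
  candidate directions; row \<open>t\<close> of \<open>M\<close> is the indicator of the \<open>t\<close>-th index set \<open>T\<close> (there are \<open>l\<close>
  of them), row \<open>t\<close> of \<open>w\<close> the point \<open>\<Sum>i\<in>T. v i\<close>, and \<open>z[t]\<close> the size of \<open>T\<close>. Entries of \<open>b\<close> and
  \<open>w\<close> are never reduced, as queries and outputs are read modulo 2; the bits \<open>q\<close> and \<open>e\<close>, however,
  are added modulo 2 in \<open>Ask\<close>, as \<open>\<bar>q - e\<bar>\<close>.\<close>

abbreviation Block :: "vname \<Rightarrow> expr \<Rightarrow> expr" where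
  "Block x t \<equiv> Cell x (Add (Cell ''u'' t) (Var ''j''))"

definition Ask :: prog where
  "Ask = Seq (Query ''e'' (Const 0) ''y'')
    (Set ''q'' (Add (Sub (Var ''q'') (Var ''e'')) (Sub (Var ''e'') (Var ''q''))))"

text \<open>Truncated subtraction of two indicator bits is \<open>1\<close> exactly for an element
  of set \<open>a\<close> outside set \<open>t\<close>, so \<open>g\<close> counts the set
  difference.\<close>

definition Test_Subset :: prog where
  "Test_Subset = Seq (Set ''g'' (Const 0)) (For ''j'' (Var ''n'')
    (Set ''g'' (Add (Var ''g'') (Sub (Block ''M'' (Var ''a'')) (Block ''M'' (Var ''t''))))))"

definition Ask_Both :: prog where
  "Ask_Both = Seq (Fill ''y'' (Const 0) (Block ''w'' (Var ''a''))) (Seq Ask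
    (Seq (Fill ''y'' (Const 0) (Add (Cell ''y'' (Var ''j'')) (Block ''b'' (Var ''i'')))) Ask))"

text \<open>Subsets of \<open>T\<close> are not enumerated but found by scanning the list of all
  stored sets.\<close>

definition Derivative :: prog where
  "Derivative = Seq (Set ''q'' (Const 0)) (For ''a'' (Var ''l'')
    (Seq Test_Subset (If (Var ''g'') Skip Ask_Both)))"

text \<open>In-place compaction with read index \<open>i\<close> and write index \<open>r\<close>.
  The flag \<open>h\<close> tells whether a pivot has been met; \<open>p\<close> keeps a copy of it,
  because its row may be overwritten.\<close>

definition Eliminate :: prog where
  "Eliminate = Seq (Set ''h'' (Const 0)) (Seq (Set ''r'' (Const 0)) (Seq (For ''i'' (Var ''m'')
    (Seq Derivative (If (Var ''q'')
      (If (Var ''h'')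
        (Seq (Fill ''b'' (Cell ''u'' (Var ''r''))
            (Add (Block ''b'' (Var ''i'')) (Cell ''p'' (Var ''j''))))
          (Set ''r'' (Add (Var ''r'') (Const 1))))
        (Seq (Fill ''p'' (Const 0) (Block ''b'' (Var ''i''))) (Set ''h'' (Const 1))))
      (Seq (Fill ''b'' (Cell ''u'' (Var ''r'')) (Block ''b'' (Var ''i'')))
        (Set ''r'' (Add (Var ''r'') (Const 1)))))))
    (Set ''m'' (Var ''r''))))"

definition Extend :: prog where
  "Extend = For ''s'' (Var ''c'') (If (Sub (Sub (Var ''d'') (Const 1)) (Cell ''z'' (Var ''s'')))
    (Seq (Fill ''M'' (Cell ''u'' (Var ''l'')) (Block ''M'' (Var ''s'')))
    (Seq (Fill ''w'' (Cell ''u'' (Var ''l''))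
        (Add (Block ''w'' (Var ''s'')) (Block ''b'' (Var ''m''))))
    (Seq (Assign ''M'' (Add (Cell ''u'' (Var ''l'')) (Var ''k'')) (Const 1))
    (Seq (Assign ''z'' (Var ''l'') (Add (Cell ''z'' (Var ''s'')) (Const 1)))
      (Set ''l'' (Add (Var ''l'') (Const 1)))))))
    Skip)"

text \<open>The guard is \<open>0\<close> iff the size is at least \<open>d - 1\<close>, hence equal
  to it for the stored sets. Smaller sets impose no equation.\<close>

definition Eliminate_New :: prog where
  "Eliminate_New = For ''x'' (Sub (Var ''l'') (Var ''c''))
    (Seq (Set ''t'' (Add (Var ''c'') (Var ''x'')))
      (If (Sub (Var ''d'') (Add (Cell ''z'' (Var ''t'')) (Const 1))) Skip Eliminate))"

text \<open>Once \<open>m\<close> is decremented, row \<open>m\<close> of \<open>b\<close> lies just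
  past the remaining candidates and still holds the one taken out; it goes to \<open>out\<close> and
  is read again by \<open>Extend\<close>. \<open>c\<close> remembers the number of old sets.\<close>

definition Step :: prog where
  "Step = Seq (Set ''m'' (Sub (Var ''m'') (Const 1)))
    (Seq (Set ''k'' (Add (Var ''k'') (Const 1)))
    (Seq (Set ''out'' (Var ''k''))
    (Seq (Fill ''out'' (Add (Const 1) (Cell ''u'' (Var ''k''))) (Block ''b'' (Var ''m'')))
    (Seq (Set ''c'' (Var ''l''))
    (Seq Extend Eliminate_New)))))"

text \<open>Zeroed memory already encodes the empty set with its point \<open>0\<close>, so
  \<open>l\<close> starts at \<open>1\<close> without any row being written; likewise the output
  base point is \<open>0\<close>.\<close>

definition Init :: prog where
  "Init = Seq (Set ''m'' (Var ''n'')) (Seq (Set ''l'' (Const 1)) (For ''i'' (Var ''n'')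
    (Seq (Assign ''b'' (Add (Cell ''u'' (Var ''i'')) (Var ''i'')) (Const 1))
      (Assign ''u'' (Add (Var ''i'') (Const 1)) (Add (Cell ''u'' (Var ''i'')) (Var ''n''))))))"

text \<open>By truncation the guard is nonzero exactly when \<open>2 * l \<le> n\<close>.\<close>

definition Main :: prog where
  "Main = Seq Init (While (Sub (Add (Var ''n'') (Const 1)) (Add (Var ''l'') (Var ''l''))) Step)"

lemma writes_Ask [simp]: "writes Ask = {''e'', ''q''}"
  by (auto simp: Ask_def)

lemma writes_Test_Subset [simp]: "writes Test_Subset = {''g'', ''j''}"
  by (auto simp: Test_Subset_def)

lemma writes_Ask_Both [simp]: "writes Ask_Both = {''e'', ''j'', ''q'', ''y''}"
  by (auto simp: Ask_Both_def)

lemma writes_Derivative [simp]: "writes Derivative = {''a'', ''e'', ''g'', ''j'', ''q'', ''y''}"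
  by (auto simp: Derivative_def)

lemma writes_Eliminate [simp]: "writes Eliminate =
    {''a'', ''b'', ''e'', ''g'', ''h'', ''i'', ''j'', ''m'', ''p'', ''q'', ''r'', ''y''}"
  by (auto simp: Eliminate_def)

lemma writes_Extend [simp]: "writes Extend = {''M'', ''j'', ''l'', ''s'', ''w'', ''z''}"
  by (auto simp: Extend_def)

lemma writes_Eliminate_New [simp]: "writes Eliminate_New = insert ''t'' (insert ''x'' (writes Eliminate))"
  by (auto simp: Eliminate_New_def)

section \<open>Row layout in memory and evaluation of derivatives\<close>

definition blk :: "nat \<Rightarrow> (nat \<Rightarrow> nat) \<Rightarrow> nat \<Rightarrow> point" where
  "blk n a t = read_point n (\<lambda>j. a (t * n + j))"

lemma read_point_cong: "(\<And>j. j < n \<Longrightarrow> a j = a' j) \<Longrightarrow> read_point n a = read_point n a'"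
  by (auto simp: read_point_def)

lemma read_point_add: "read_point n (\<lambda>j. a j + a' j) = read_point n a + read_point n a'"
  by (auto simp: read_point_def)

lemma read_point_in_F2 [simp]: "read_point n a \<in> F2 n"
  by (simp add: read_point_def F2_def)

lemma block_index_eq_iff: "j < n \<Longrightarrow> j' < n \<Longrightarrow> t * n + j = t' * n + j' \<longleftrightarrow> t = t' \<and> j = j'" for j :: nat
proof
  assume j: "j < n" "j' < n" and eq: "t * n + j = t' * n + j'"
  have "(t * n + j) div n = t" "(t' * n + j') div n = t'" using j by auto
  with eq show "t = t' \<and> j = j'" by simp
qed simp

lemma block_index_notin:
  fixes n t t' j :: nat
  assumes "j < n" "t \<noteq> t'"
  shows "t * n + j \<notin> {t' * n..<t' * n + n}"
proof
  assume "t * n + j \<in> {t' * n..<t' * n + n}"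
  then obtain j' where "j' < n" "t * n + j = t' * n + j'"
    by (metis add_less_cancel_left atLeastLessThan_iff le_Suc_ex)
  with assms block_index_eq_iff show False by blast
qed

definition multiples :: "nat \<Rightarrow> state \<Rightarrow> bool" where
  "multiples n s \<longleftrightarrow> s ''n'' 0 = n \<and> (\<forall>i\<le>n. s ''u'' i = i * n)"

lemma halts_Ask:
  assumes "s ''q'' 0 = of_bool (\<beta> = (1::bit))"
  shows "halts n f Ask s (n + 20) (\<lambda>s'. s' ''q'' 0 = of_bool (\<beta> + f (read_point n (s ''y'')) = 1))"
proof -
  have "halts n f Ask s ((1 + n + cost (Const 0)) + (1 + cost (Const 0) +
      cost (Add (Sub (Var ''q'') (Var ''e'')) (Sub (Var ''e'') (Var ''q'')))))
    (\<lambda>s'. s' ''q'' 0 = of_bool (\<beta> + f (read_point n (s ''y'')) = 1))"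
    unfolding Ask_def
    by (rule halts_Seq[OF halts_Query[where Q = "\<lambda>s'. s' = put s ''e'' 0
        (of_bool (f (read_point n (s ''y'')) = 1))"]], simp, rule halts_Assign)
      (use assms in \<open>auto simp: put_def\<close>)
  then show ?thesis by (rule halts_weaken) auto
qed

lemma halts_Test_Subset:
  assumes s: "multiples n s" "s ''a'' 0 = a" "s ''t'' 0 = t" "a < n" "t < n"
    and M: "\<And>i. i < n \<Longrightarrow> s ''M'' (a * n + i) = of_bool (i \<in> A)"
      "\<And>i. i < n \<Longrightarrow> s ''M'' (t * n + i) = of_bool (i \<in> T)"
    and "A \<subseteq> {..<n}"
  shows "halts n f Test_Subset s (60 * (n + 1)) (\<lambda>s'. s' ''g'' 0 = 0 \<longleftrightarrow> A \<subseteq> T)"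
proof -
  let ?e = "Add (Var ''g'') (Sub (Block ''M'' (Var ''a'')) (Block ''M'' (Var ''t'')))"
  let ?s = "put s ''g'' 0 0"
  have "halts n f (For ''j'' (Var ''n'') (Set ''g'' ?e)) ?s
    ((n + 1) * ((1 + cost (Const 0) + cost ?e) + cost (Var ''n'') + 15))
    (\<lambda>s'. s' ''g'' 0 = 0 \<longleftrightarrow> A \<inter> {..<n} \<subseteq> T)"
  proof (rule halts_For)
    fix i s' assume i: "i < n" "s' ''j'' 0 = i" and g: "s' ''g'' 0 = 0 \<longleftrightarrow> A \<inter> {..<i} \<subseteq> T"
      and fr: "\<And>y. y \<notin> insert ''j'' (writes (Set ''g'' ?e)) \<Longrightarrow> s' y = ?s y"
    have "s' ''u'' = s ''u''" "s' ''M'' = s ''M''" "s' ''a'' = s ''a''" "s' ''t'' = s ''t''"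
      using fr by (auto simp: put_def)
    with s i have v: "val ?e s' = s' ''g'' 0 + (of_bool (i \<in> A) - of_bool (i \<in> T))"
      using M[OF i(1)] by (simp add: multiples_def)
    show "halts n f (Set ''g'' ?e) s' (1 + cost (Const 0) + cost ?e)
        (\<lambda>s'. s' ''g'' 0 = 0 \<longleftrightarrow> A \<inter> {..<Suc i} \<subseteq> T)"
      by (rule halts_Assign, subst v) (use g in \<open>auto simp: put_def lessThan_Suc\<close>)
  qed (use s in \<open>auto simp: put_def multiples_def\<close>)
  then have "halts n f Test_Subset s (1 + cost (Const 0) + cost (Const 0) +
     ((n + 1) * ((1 + cost (Const 0) + cost ?e) + cost (Var ''n'') + 15)))
    (\<lambda>s'. s' ''g'' 0 = 0 \<longleftrightarrow> A \<inter> {..<n} \<subseteq> T)"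
    unfolding Test_Subset_def by (intro halts_Assign_Seq) simp
  moreover have "A \<inter> {..<n} = A" using \<open>A \<subseteq> {..<n}\<close> by blast
  ultimately have "halts n f Test_Subset s (1 + cost (Const 0) + cost (Const 0) +
     ((n + 1) * ((1 + cost (Const 0) + cost ?e) + cost (Var ''n'') + 15)))
    (\<lambda>s'. s' ''g'' 0 = 0 \<longleftrightarrow> A \<subseteq> T)" by simp
  then show ?thesis by (rule halts_weaken) auto
qed

lemma halts_Ask_Both:
  assumes s: "multiples n s" "s ''a'' 0 < n" "s ''i'' 0 < n"
    and q: "s ''q'' 0 = of_bool (\<beta> = (1::bit))"
    and x: "x = blk n (s ''w'') (s ''a'' 0)" and b: "b = blk n (s ''b'') (s ''i'' 0)"
  shows "halts n f Ask_Both s (150 * (n + 1)) (\<lambda>s'. s' ''q'' 0 = of_bool (\<beta> + (f x + f (x + b)) = 1))"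
proof -
  let ?e1 = "Block ''w'' (Var ''a'')" and ?e2 = "Add (Cell ''y'' (Var ''j'')) (Block ''b'' (Var ''i''))"
  have "halts n f Ask_Both s
    ((n + 1) * (cost (Const 0) + cost ?e1 + 25) + ((n + 20) +
    ((n + 1) * (cost (Const 0) + cost ?e2 + 25) + (n + 20))))
    (\<lambda>s'. s' ''q'' 0 = of_bool (\<beta> + (f x + f (x + b)) = 1))"
    unfolding Ask_Both_def
  proof (rule halts_Seq)
    show "halts n f (Fill ''y'' (Const 0) ?e1) s ((n + 1) * (cost (Const 0) + cost ?e1 + 25))
      (\<lambda>s'. (\<forall>j<n. s' ''y'' (0 + j) = s ''w'' (s ''a'' 0 * n + j)) \<and>
        (\<forall>i. i \<notin> {0..<0 + n} \<longrightarrow> s' ''y'' i = s ''y'' i))"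
      by (rule halts_Fill) (use s in \<open>auto simp: multiples_def\<close>)
    fix s1
    assume y1: "(\<forall>j<n. s1 ''y'' (0 + j) = s ''w'' (s ''a'' 0 * n + j)) \<and>
        (\<forall>i. i \<notin> {0..<0 + n} \<longrightarrow> s1 ''y'' i = s ''y'' i)"
      and fr1: "\<And>y. y \<notin> writes (Fill ''y'' (Const 0) ?e1) \<Longrightarrow> s1 y = s y"
    have x1: "read_point n (s1 ''y'') = x"
      using y1 unfolding x blk_def by (intro read_point_cong) auto
    show "halts n f (Seq Ask (Seq (Fill ''y'' (Const 0) ?e2) Ask)) s1
      ((n + 20) + ((n + 1) * (cost (Const 0) + cost ?e2 + 25) + (n + 20)))
      (\<lambda>s'. s' ''q'' 0 = of_bool (\<beta> + (f x + f (x + b)) = 1))"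
    proof (rule halts_Seq)
      show "halts n f Ask s1 (n + 20) (\<lambda>s'. s' ''q'' 0 = of_bool (\<beta> + f x = 1))"
        unfolding x1[symmetric] by (rule halts_Ask) (use q fr1 in auto)
      fix s2
      assume q2: "s2 ''q'' 0 = of_bool (\<beta> + f x = 1)"
        and fr2: "\<And>y. y \<notin> writes Ask \<Longrightarrow> s2 y = s1 y"
      show "halts n f (Seq (Fill ''y'' (Const 0) ?e2) Ask) s2
        ((n + 1) * (cost (Const 0) + cost ?e2 + 25) + (n + 20))
        (\<lambda>s'. s' ''q'' 0 = of_bool (\<beta> + (f x + f (x + b)) = 1))"
      proof (rule halts_Seq)
        show "halts n f (Fill ''y'' (Const 0) ?e2) s2 ((n + 1) * (cost (Const 0) + cost ?e2 + 25))
          (\<lambda>s'. (\<forall>j<n. s' ''y'' (0 + j) = s1 ''y'' j + s ''b'' (s ''i'' 0 * n + j)) \<and>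
            (\<forall>i. i \<notin> {0..<0 + n} \<longrightarrow> s' ''y'' i = s2 ''y'' i))"
          by (rule halts_Fill) (use s fr1 fr2 in \<open>auto simp: multiples_def\<close>)
        fix s3
        assume y3: "(\<forall>j<n. s3 ''y'' (0 + j) = s1 ''y'' j + s ''b'' (s ''i'' 0 * n + j)) \<and>
            (\<forall>i. i \<notin> {0..<0 + n} \<longrightarrow> s3 ''y'' i = s2 ''y'' i)"
          and fr3: "\<And>y. y \<notin> writes (Fill ''y'' (Const 0) ?e2) \<Longrightarrow> s3 y = s2 y"
        have "read_point n (s3 ''y'') = x + b"
          unfolding x1[symmetric] b blk_def read_point_add[symmetric]
          using y3 by (intro read_point_cong) auto
        moreover have "halts n f Ask s3 (n + 20)
          (\<lambda>s'. s' ''q'' 0 = of_bool ((\<beta> + f x) + f (read_point n (s3 ''y'')) = 1))"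
          by (rule halts_Ask) (use q2 fr3 in auto)
        ultimately show "halts n f Ask s3 (n + 20)
            (\<lambda>s'. s' ''q'' 0 = of_bool (\<beta> + (f x + f (x + b)) = 1))"
          by (simp only: add.assoc)
      qed
    qed
  qed
  then show ?thesis by (rule halts_weaken) auto
qed

text \<open>\<open>M\<close> must hold true 0/1 numbers for \<open>Test_Subset\<close>, whereas
  \<open>w\<close> matters only modulo 2. \<open>length Ls \<le> n\<close> keeps row starts inside
  the lookup table \<open>u\<close>.\<close>

definition stores_sets :: "nat \<Rightarrow> (nat \<Rightarrow> point) \<Rightarrow> nat set list \<Rightarrow> state \<Rightarrow> bool" where
  "stores_sets n v Ls s \<longleftrightarrow> s ''l'' 0 = length Ls \<and> length Ls \<le> n \<and>
    (\<forall>t<length Ls. Ls ! t \<subseteq> {..<n} \<and> s ''z'' t = card (Ls ! t) \<and>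
      (\<forall>i<n. s ''M'' (t * n + i) = of_bool (i \<in> Ls ! t)) \<and>
      blk n (s ''w'') t = (\<Sum>i\<in>Ls ! t. v i))"

definition stores_points :: "nat \<Rightarrow> point list \<Rightarrow> state \<Rightarrow> bool" where
  "stores_points n B s \<longleftrightarrow> s ''m'' 0 = length B \<and> length B \<le> n \<and>
    (\<forall>i<length B. blk n (s ''b'') i = B ! i)"

lemma sum_list_members:
  fixes F :: "'a \<Rightarrow> 'b::comm_monoid_add"
  assumes "distinct xs" "S \<subseteq> set xs"
  shows "(\<Sum>a<length xs. if xs ! a \<in> S then F (xs ! a) else 0) = (\<Sum>x\<in>S. F x)"
proof -
  have "(\<Sum>a<length xs. if xs ! a \<in> S then F (xs ! a) else 0) = (\<Sum>x\<in>set xs. if x \<in> S then F x else 0)"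
    by (rule sum.reindex_bij_betw) (rule bij_betw_nth[OF assms(1)]; simp)
  also have "\<dots> = (\<Sum>x\<in>set xs \<inter> S. F x)"
    by (simp add: sum.inter_restrict)
  also have "set xs \<inter> S = S" using assms by blast
  finally show ?thesis .
qed

text \<open>The iterated derivative of \<open>f\<close> at \<open>0\<close> along \<open>b\<close>
  and all \<open>v i\<close> with \<open>i\<close> in \<open>T\<close>.\<close>

definition deriv :: "(point \<Rightarrow> bit) \<Rightarrow> (nat \<Rightarrow> point) \<Rightarrow> nat set \<Rightarrow> point \<Rightarrow> bit" where
  "deriv f v T b = (\<Sum>A\<in>Pow T. f (\<Sum>i\<in>A. v i) + f ((\<Sum>i\<in>A. v i) + b))"

lemma halts_Derivative:
  assumes s: "multiples n s" "s ''i'' 0 < n" "s ''t'' 0 = t" "t < length Ls"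
    and Ls: "stores_sets n v Ls s" "distinct Ls" "Pow (Ls ! t) \<subseteq> set Ls"
    and b: "b = blk n (s ''b'') (s ''i'' 0)"
  shows "halts n f Derivative s (250 * (n + 1) ^ 2)
    (\<lambda>s'. s' ''q'' 0 = of_bool (deriv f v (Ls ! t) b = 1))"
proof -
  define F where "F A = f (\<Sum>i\<in>A. v i) + f ((\<Sum>i\<in>A. v i) + b)" for A
  \<comment> \<open>The value accumulated in \<open>q\<close> after scanning \<open>a\<close> sets.
    As the list has no repetitions and contains all subsets of \<open>Ls ! t\<close>, the full sum
    is the derivative.\<close>
  define G where "G a = (\<Sum>a<a. if Ls ! a \<in> Pow (Ls ! t) then F (Ls ! a) else 0)" for a
  have len: "length Ls \<le> n" "s ''l'' 0 = length Ls"
    and M: "\<And>t i. t < length Ls \<Longrightarrow> i < n \<Longrightarrow> s ''M'' (t * n + i) = of_bool (i \<in> Ls ! t)"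
    and w: "\<And>t. t < length Ls \<Longrightarrow> (\<Sum>i\<in>Ls ! t. v i) = blk n (s ''w'') t"
    and sub: "\<And>t. t < length Ls \<Longrightarrow> Ls ! t \<subseteq> {..<n}"
    using Ls(1) unfolding stores_sets_def by simp_all
  let ?P = "Seq Test_Subset (If (Var ''g'') Skip Ask_Both)"
  let ?s = "put s ''q'' 0 0"
  let ?t = "60 * (n + 1) + (1 + cost (Var ''g'') + max 1 (150 * (n + 1)))"
  have "halts n f (For ''a'' (Var ''l'') ?P) ?s
    ((length Ls + 1) * (?t + cost (Var ''l'') + 15)) (\<lambda>s'. s' ''q'' 0 = of_bool (G (length Ls) = 1))"
  proof (rule halts_For)
    fix a s' assume a: "a < length Ls" "s' ''a'' 0 = a" and q: "s' ''q'' 0 = of_bool (G a = 1)"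
      and fr: "\<And>y. y \<notin> insert ''a'' (writes ?P) \<Longrightarrow> s' y = ?s y"
    have eqs: "s' ''u'' = s ''u''" "s' ''n'' = s ''n''" "s' ''M'' = s ''M''" "s' ''w'' = s ''w''"
      "s' ''b'' = s ''b''" "s' ''t'' = s ''t''" "s' ''i'' = s ''i''"
      using fr by (auto simp: put_def)
    have an: "a < n" and tn: "t < n" and m': "multiples n s'"
      using a s len eqs by (simp_all add: multiples_def)
    show "halts n f ?P s' ?t (\<lambda>s'. s' ''q'' 0 = of_bool (G (Suc a) = 1))"
    proof (rule halts_Seq)
      show "halts n f Test_Subset s' (60 * (n + 1)) (\<lambda>s'. s' ''g'' 0 = 0 \<longleftrightarrow> Ls ! a \<subseteq> Ls ! t)"
        by (rule halts_Test_Subset[OF m' a(2) _ an tn])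
          (use s a eqs M sub in \<open>simp_all\<close>)
      fix s1 assume g: "s1 ''g'' 0 = 0 \<longleftrightarrow> Ls ! a \<subseteq> Ls ! t"
        and fr1: "\<And>y. y \<notin> writes Test_Subset \<Longrightarrow> s1 y = s' y"
      have eqs1: "s1 ''u'' = s ''u''" "s1 ''n'' = s ''n''" "s1 ''w'' = s ''w''"
        "s1 ''b'' = s ''b''" "s1 ''i'' = s ''i''" "s1 ''a'' = s' ''a''" "s1 ''q'' = s' ''q''"
        using fr1 eqs by auto
      show "halts n f (If (Var ''g'') Skip Ask_Both) s1
        (1 + cost (Var ''g'') + max 1 (150 * (n + 1))) (\<lambda>s'. s' ''q'' 0 = of_bool (G (Suc a) = 1))"
      proof (rule halts_If)
        assume "val (Var ''g'') s1 \<noteq> 0"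
        with g q eqs1 have "s1 ''q'' 0 = of_bool (G (Suc a) = 1)" by (simp add: G_def)
        show "halts n f Skip s1 1 (\<lambda>s'. s' ''q'' 0 = of_bool (G (Suc a) = 1))"
          by (rule halts_Skip) fact
      next
        assume "val (Var ''g'') s1 = 0"
        with g have sub: "Ls ! a \<subseteq> Ls ! t" by simp
        have w: "(\<Sum>i\<in>Ls ! a. v i) = blk n (s1 ''w'') (s1 ''a'' 0)"
          using w a eqs1 by simp
        have "halts n f Ask_Both s1 (150 * (n + 1)) (\<lambda>s'. s' ''q'' 0 = of_bool (G a +
          (f (\<Sum>i\<in>Ls ! a. v i) + f ((\<Sum>i\<in>Ls ! a. v i) + b)) = 1))"
          by (rule halts_Ask_Both[OF _ _ _ _ w])
            (use m' s a an eqs eqs1 b q in \<open>auto simp: multiples_def\<close>)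
        moreover have "G a + (f (\<Sum>i\<in>Ls ! a. v i) + f ((\<Sum>i\<in>Ls ! a. v i) + b)) = G (Suc a)"
          using sub unfolding G_def F_def by simp
        ultimately show "halts n f Ask_Both s1 (150 * (n + 1)) (\<lambda>s'. s' ''q'' 0 = of_bool (G (Suc a) = 1))"
          by metis
      qed
    qed
  qed (use len in \<open>simp_all add: put_def G_def\<close>)
  then have "halts n f Derivative s (1 + cost (Const 0) + cost (Const 0) +
    ((length Ls + 1) * (?t + cost (Var ''l'') + 15))) (\<lambda>s'. s' ''q'' 0 = of_bool (G (length Ls) = 1))"
    unfolding Derivative_def by (intro halts_Assign_Seq) simp
  moreover have "G (length Ls) = deriv f v (Ls ! t) b"
    unfolding G_def deriv_def F_def using Ls by (subst sum_list_members) auto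
  ultimately have *: "halts n f Derivative s (1 + cost (Const 0) + cost (Const 0) +
    ((length Ls + 1) * (?t + cost (Var ''l'') + 15)))
    (\<lambda>s'. s' ''q'' 0 = of_bool (deriv f v (Ls ! t) b = 1))" by simp
  have "(length Ls + 1) * (?t + cost (Var ''l'') + 15) \<le> (n + 1) * (240 * (n + 1))"
    using len by (intro mult_mono) auto
  moreover have "3 \<le> 10 * (n + 1) ^ 2" by (simp add: power2_eq_square)
  ultimately have "1 + cost (Const 0) + cost (Const 0) +
    ((length Ls + 1) * (?t + cost (Var ''l'') + 15)) \<le> 250 * (n + 1) ^ 2"
    by (simp add: power2_eq_square algebra_simps)
  with * show ?thesis by (rule halts_weaken)
qed

section \<open>In-place elimination and its functional counterpart\<close>

lemma blk_write:
  assumes "\<forall>j<n. a' (r * n + j) = g j" "\<forall>i. i \<notin> {r * n..<r * n + n} \<longrightarrow> a' i = a i"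
  shows "blk n a' r = read_point n g" "t \<noteq> r \<Longrightarrow> blk n a' t = blk n a t"
  using assms block_index_notin unfolding blk_def by (auto intro!: read_point_cong)

lemma halts_push:
  assumes s: "multiples n s" "s ''r'' 0 = r" "r < n"
    and e: "\<And>s' j. j < n \<Longrightarrow> s' ''j'' 0 = j \<Longrightarrow> (\<And>i. i \<notin> {r * n..<r * n + j} \<Longrightarrow> s' ''b'' i = s ''b'' i)
      \<Longrightarrow> (\<And>y. y \<notin> {''j'', ''b''} \<Longrightarrow> s' y = s y) \<Longrightarrow> val e s' = g j"
  shows "halts n f (Seq (Fill ''b'' (Cell ''u'' (Var ''r'')) e) (Set ''r'' (Add (Var ''r'') (Const 1)))) s
    ((n + 1) * (cost e + 40)) (\<lambda>s'. s' ''r'' 0 = Suc r \<and> blk n (s' ''b'') r = read_point n g \<and>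
      (\<forall>t. t \<noteq> r \<longrightarrow> blk n (s' ''b'') t = blk n (s ''b'') t))"
proof -
  have "halts n f (Seq (Fill ''b'' (Cell ''u'' (Var ''r'')) e) (Set ''r'' (Add (Var ''r'') (Const 1)))) s
    ((n + 1) * (cost (Cell ''u'' (Var ''r'')) + cost e + 25) +
      (1 + cost (Const 0) + cost (Add (Var ''r'') (Const 1))))
    (\<lambda>s'. s' ''r'' 0 = Suc r \<and> blk n (s' ''b'') r = read_point n g \<and>
      (\<forall>t. t \<noteq> r \<longrightarrow> blk n (s' ''b'') t = blk n (s ''b'') t))"
  proof (rule halts_Seq)
    show "halts n f (Fill ''b'' (Cell ''u'' (Var ''r'')) e) s
      ((n + 1) * (cost (Cell ''u'' (Var ''r'')) + cost e + 25))
      (\<lambda>s'. (\<forall>j<n. s' ''b'' (r * n + j) = g j) \<and>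
        (\<forall>i. i \<notin> {r * n..<r * n + n} \<longrightarrow> s' ''b'' i = s ''b'' i))"
      by (rule halts_Fill) (use s e in \<open>auto simp: multiples_def\<close>)
    fix s1 assume "(\<forall>j<n. s1 ''b'' (r * n + j) = g j) \<and>
        (\<forall>i. i \<notin> {r * n..<r * n + n} \<longrightarrow> s1 ''b'' i = s ''b'' i)"
      and fr: "\<And>y. y \<notin> writes (Fill ''b'' (Cell ''u'' (Var ''r'')) e) \<Longrightarrow> s1 y = s y"
    then have "blk n (s1 ''b'') r = read_point n g"
      "\<And>t. t \<noteq> r \<Longrightarrow> blk n (s1 ''b'') t = blk n (s ''b'') t"
      using blk_write by blast+
    with fr[of "''r''"] s
    show "halts n f (Set ''r'' (Add (Var ''r'') (Const 1))) s1
      (1 + cost (Const 0) + cost (Add (Var ''r'') (Const 1)))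
      (\<lambda>s'. s' ''r'' 0 = Suc r \<and> blk n (s' ''b'') r = read_point n g \<and>
        (\<forall>t. t \<noteq> r \<longrightarrow> blk n (s' ''b'') t = blk n (s ''b'') t))"
      by (intro halts_Assign) (auto simp: put_def)
  qed
  then show ?thesis by (rule halts_weaken) (auto simp: algebra_simps)
qed

text \<open>One Gaussian pivoting step for a single equation. The pivot found so far is an argument,
  so that the recursion mirrors the single left-to-right pass of the loop.\<close>

fun eliminate :: "(point \<Rightarrow> bit) \<Rightarrow> point option \<Rightarrow> point list \<Rightarrow> point list" where
  "eliminate \<phi> p [] = []"
| "eliminate \<phi> p (b # bs) = (if \<phi> b = 0 then b # eliminate \<phi> p bs else
    (case p of None \<Rightarrow> eliminate \<phi> (Some b) bs | Some c \<Rightarrow> (b + c) # eliminate \<phi> p bs))"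

text \<open>The loop invariant: \<open>R\<close> is the output written so far, and the recursion on
  \<open>drop i B\<close> with pivot \<open>p\<close> is what remains.
  \<open>length R \<le> i\<close> makes overwriting safe.\<close>

definition eliminating :: "nat \<Rightarrow> (point \<Rightarrow> bit) \<Rightarrow> point list \<Rightarrow> nat \<Rightarrow> state \<Rightarrow> bool" where
  "eliminating n \<phi> B i s \<longleftrightarrow> (\<exists>p R. R @ eliminate \<phi> p (drop i B) = eliminate \<phi> None B \<and>
    s ''r'' 0 = length R \<and> length R \<le> i \<and> (\<forall>t<length R. blk n (s ''b'') t = R ! t) \<and>
    (\<forall>t. i \<le> t \<and> t < length B \<longrightarrow> blk n (s ''b'') t = B ! t) \<and>
    (case p of None \<Rightarrow> s ''h'' 0 = 0 | Some c \<Rightarrow> s ''h'' 0 \<noteq> 0 \<and> read_point n (s ''p'') = c))"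

lemma eliminating_push:
  assumes "R @ x # eliminate \<phi> p (drop (Suc i) B) = eliminate \<phi> None B"
    and "length R \<le> i" "\<forall>t<length R. blk n (s ''b'') t = R ! t"
    and "\<forall>t. i \<le> t \<and> t < length B \<longrightarrow> blk n (s ''b'') t = B ! t"
    and "case p of None \<Rightarrow> s' ''h'' 0 = 0 | Some c \<Rightarrow> s' ''h'' 0 \<noteq> 0 \<and> read_point n (s' ''p'') = c"
    and "s' ''r'' 0 = Suc (length R) \<and> blk n (s' ''b'') (length R) = x \<and>
      (\<forall>t. t \<noteq> length R \<longrightarrow> blk n (s' ''b'') t = blk n (s ''b'') t)"
  shows "eliminating n \<phi> B (Suc i) s'"
  unfolding eliminating_def
  by (rule exI[of _ p], rule exI[of _ "R @ [x]"])
    (use assms in \<open>auto simp: nth_append less_Suc_eq\<close>)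

lemma halts_Eliminate:
  assumes s: "multiples n s" "s ''t'' 0 = t" "t < length Ls"
    and Ls: "stores_sets n v Ls s" "distinct Ls" "Pow (Ls ! t) \<subseteq> set Ls"
    and B: "stores_points n B s"
  shows "halts n f Eliminate s (500 * (n + 1) ^ 3)
    (stores_points n (eliminate (deriv f v (Ls ! t)) None B))"
proof -
  let ?\<phi> = "deriv f v (Ls ! t)"
  let ?Push = "\<lambda>e. Seq (Fill ''b'' (Cell ''u'' (Var ''r'')) e) (Set ''r'' (Add (Var ''r'') (Const 1)))"
  let ?e = "Add (Block ''b'' (Var ''i'')) (Cell ''p'' (Var ''j''))"
  let ?Pivot = "Seq (Fill ''p'' (Const 0) (Block ''b'' (Var ''i''))) (Set ''h'' (Const 1))"
  let ?If = "If (Var ''q'') (If (Var ''h'') (?Push ?e) ?Pivot) (?Push (Block ''b'' (Var ''i'')))"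
  let ?P = "Seq Derivative ?If"
  let ?T1 = "(n + 1) * (cost ?e + 40)"
  let ?T2 = "(n + 1) * (cost (Const 0) + cost (Block ''b'' (Var ''i'')) + 25) + (1 + cost (Const 0) + cost (Const 1))"
  let ?T3 = "(n + 1) * (cost (Block ''b'' (Var ''i'')) + 40)"
  let ?T = "1 + cost (Var ''q'') + max (1 + cost (Var ''h'') + max ?T1 ?T2) ?T3"
  let ?s = "put (put s ''h'' 0 0) ''r'' 0 0"
  let ?t = "250 * (n + 1) ^ 2 + ?T"
  have lenB: "length B \<le> n" "s ''m'' 0 = length B" "\<And>i. i < length B \<Longrightarrow> blk n (s ''b'') i = B ! i"
    using B by (simp_all add: stores_points_def)
  have len: "length Ls \<le> n" using Ls(1) by (simp add: stores_sets_def)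
  have For: "halts n f (For ''i'' (Var ''m'') ?P) ?s
    ((length B + 1) * (?t + cost (Var ''m'') + 15)) (eliminating n ?\<phi> B (length B))"
  proof (rule halts_For)
    show "eliminating n ?\<phi> B 0 s'" if "\<And>y. y \<noteq> ''i'' \<Longrightarrow> s' y = ?s y" for s'
      unfolding eliminating_def using lenB that
      by (intro exI[of _ None] exI[of _ "[]"]) (simp add: put_def)
    fix i s' assume i: "i < length B" "s' ''i'' 0 = i" and inv: "eliminating n ?\<phi> B i s'"
      and fr: "\<And>y. y \<notin> insert ''i'' (writes ?P) \<Longrightarrow> s' y = ?s y"
    have eqs: "s' ''u'' = s ''u''" "s' ''n'' = s ''n''" "s' ''M'' = s ''M''" "s' ''w'' = s ''w''"
      "s' ''t'' = s ''t''" "s' ''l'' = s ''l''" "s' ''z'' = s ''z''"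
      using fr by (simp_all add: put_def)
    have m': "multiples n s'" and Ls': "stores_sets n v Ls s'"
      using s(1) Ls(1) eqs by (simp_all add: multiples_def stores_sets_def)
    have "i < n" using i lenB by simp
    obtain p R where R: "R @ eliminate ?\<phi> p (drop i B) = eliminate ?\<phi> None B"
      and r: "s' ''r'' 0 = length R" "length R \<le> i" and bR: "\<forall>t<length R. blk n (s' ''b'') t = R ! t"
      and bB: "\<forall>t. i \<le> t \<and> t < length B \<longrightarrow> blk n (s' ''b'') t = B ! t"
      and p: "case p of None \<Rightarrow> s' ''h'' 0 = 0 | Some c \<Rightarrow> s' ''h'' 0 \<noteq> 0 \<and> read_point n (s' ''p'') = c"
      using inv unfolding eliminating_def by blast
    have rn: "length R < n" using r \<open>i < n\<close> by simp
    have drop: "drop i B = B ! i # drop (Suc i) B" using i by (simp add: Cons_nth_drop_Suc)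
    have Bi: "B ! i = read_point n (\<lambda>j. s' ''b'' (i * n + j))" using bB i by (auto simp: blk_def)
    show "halts n f ?P s' ?t (eliminating n ?\<phi> B (Suc i))"
    proof (rule halts_Seq)
      show "halts n f Derivative s' (250 * (n + 1) ^ 2) (\<lambda>s'. s' ''q'' 0 = of_bool (?\<phi> (B ! i) = 1))"
        by (rule halts_Derivative[OF m' _ _ s(3) Ls' Ls(2,3)]) (use i bB s eqs \<open>i < n\<close> in simp_all)
      fix s1 assume q: "s1 ''q'' 0 = of_bool (?\<phi> (B ! i) = 1)"
        and fr1: "\<And>y. y \<notin> writes Derivative \<Longrightarrow> s1 y = s' y"
      have eqs1: "s1 ''u'' = s ''u''" "s1 ''n'' = s ''n''" "s1 ''i'' = s' ''i''" "s1 ''b'' = s' ''b''"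
        "s1 ''p'' = s' ''p''" "s1 ''r'' = s' ''r''" "s1 ''h'' = s' ''h''"
        using fr1 eqs by simp_all
      have m1: "multiples n s1" using s(1) eqs1 by (simp add: multiples_def)
      have u: "s1 ''u'' i = i * n" using m1 \<open>i < n\<close> by (simp add: multiples_def)
      \<comment> \<open>If \<open>length R = i\<close>, the row is overwritten in place: cell
        \<open>j\<close> is read before it is written, and only the cells before \<open>j\<close>
        have changed.\<close>
      have notin: "i * n + j \<notin> {length R * n..<length R * n + j}" for j
        using mult_le_mono1[OF r(2), of n] by auto
      show "halts n f ?If s1 ?T (eliminating n ?\<phi> B (Suc i))"
      proof (rule halts_If)
        assume "val (Var ''q'') s1 \<noteq> 0"
        with q have phi: "?\<phi> (B ! i) \<noteq> 0" by auto
        show "halts n f (If (Var ''h'') (?Push ?e) ?Pivot) s1 (1 + cost (Var ''h'') + max ?T1 ?T2)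
          (eliminating n ?\<phi> B (Suc i))"
        proof (rule halts_If)
          assume "val (Var ''h'') s1 \<noteq> 0"
          with p eqs1 obtain c where c: "p = Some c" "read_point n (s' ''p'') = c"
            by (auto split: option.splits)
          let ?g = "\<lambda>j. s' ''b'' (i * n + j) + s' ''p'' j"
          have "halts n f (?Push ?e) s1 ?T1 (\<lambda>s'. s' ''r'' 0 = Suc (length R) \<and>
              blk n (s' ''b'') (length R) = read_point n ?g \<and>
              (\<forall>t. t \<noteq> length R \<longrightarrow> blk n (s' ''b'') t = blk n (s1 ''b'') t))"
            by (rule halts_push[OF m1 _ rn]) (use r eqs1 i u notin in simp_all)
          then show "halts n f (?Push ?e) s1 ?T1 (eliminating n ?\<phi> B (Suc i))"
          proof (rule halts_weaken)
            fix s2 assume s2: "s2 ''r'' 0 = Suc (length R) \<and>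
              blk n (s2 ''b'') (length R) = read_point n ?g \<and>
              (\<forall>t. t \<noteq> length R \<longrightarrow> blk n (s2 ''b'') t = blk n (s1 ''b'') t)"
              and fr2: "\<And>y. y \<notin> writes (?Push ?e) \<Longrightarrow> s2 y = s1 y"
            show "eliminating n ?\<phi> B (Suc i) s2"
              by (rule eliminating_push[where R = R and s = s' and p = p and x = "read_point n ?g"])
                (use s2 fr2 eqs1 r bR bB R drop phi c p in \<open>simp_all add: read_point_add Bi\<close>)
          qed simp
        next
          assume "val (Var ''h'') s1 = 0"
          with p eqs1 have none: "p = None" by (auto split: option.splits)
          show "halts n f ?Pivot s1 ?T2 (eliminating n ?\<phi> B (Suc i))"
          proof (rule halts_Seq)
            show "halts n f (Fill ''p'' (Const 0) (Block ''b'' (Var ''i''))) s1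
              ((n + 1) * (cost (Const 0) + cost (Block ''b'' (Var ''i'')) + 25))
              (\<lambda>s'. (\<forall>j<n. s' ''p'' (0 + j) = s1 ''b'' (i * n + j)) \<and>
                (\<forall>i. i \<notin> {0..<0 + n} \<longrightarrow> s' ''p'' i = s1 ''p'' i))"
              by (rule halts_Fill) (use m1 eqs1 i u in \<open>simp_all add: multiples_def\<close>)
            fix s2 assume s2: "(\<forall>j<n. s2 ''p'' (0 + j) = s1 ''b'' (i * n + j)) \<and>
                (\<forall>i. i \<notin> {0..<0 + n} \<longrightarrow> s2 ''p'' i = s1 ''p'' i)"
              and fr2: "\<And>y. y \<notin> writes (Fill ''p'' (Const 0) (Block ''b'' (Var ''i''))) \<Longrightarrow> s2 y = s1 y"
            have "read_point n (s2 ''p'') = B ! i"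
              unfolding Bi using s2 eqs1 by (intro read_point_cong) simp
            then have "eliminating n ?\<phi> B (Suc i) (put s2 ''h'' 0 1)"
              unfolding eliminating_def
              by (intro exI[of _ "Some (B ! i)"] exI[of _ R])
                (use R drop phi none r bR bB fr2 eqs1 in \<open>simp add: put_def\<close>)
            then show "halts n f (Set ''h'' (Const 1)) s2 (1 + cost (Const 0) + cost (Const 1))
              (eliminating n ?\<phi> B (Suc i))"
              by (intro halts_Assign) simp
          qed
        qed
      next
        assume "val (Var ''q'') s1 = 0"
        with q have phi: "?\<phi> (B ! i) = 0" by (auto split: if_splits)
        let ?g = "\<lambda>j. s' ''b'' (i * n + j)"
        have "halts n f (?Push (Block ''b'' (Var ''i''))) s1 ?T3 (\<lambda>s'. s' ''r'' 0 = Suc (length R) \<and>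
            blk n (s' ''b'') (length R) = read_point n ?g \<and>
            (\<forall>t. t \<noteq> length R \<longrightarrow> blk n (s' ''b'') t = blk n (s1 ''b'') t))"
          by (rule halts_push[OF m1 _ rn]) (use r eqs1 i u notin in simp_all)
        then show "halts n f (?Push (Block ''b'' (Var ''i''))) s1 ?T3 (eliminating n ?\<phi> B (Suc i))"
        proof (rule halts_weaken)
          fix s2 assume s2: "s2 ''r'' 0 = Suc (length R) \<and>
            blk n (s2 ''b'') (length R) = read_point n ?g \<and>
            (\<forall>t. t \<noteq> length R \<longrightarrow> blk n (s2 ''b'') t = blk n (s1 ''b'') t)"
            and fr2: "\<And>y. y \<notin> writes (?Push (Block ''b'' (Var ''i''))) \<Longrightarrow> s2 y = s1 y"
          show "eliminating n ?\<phi> B (Suc i) s2"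
            by (rule eliminating_push[where R = R and s = s' and p = p and x = "read_point n ?g"])
              (use s2 fr2 eqs1 r bR bB R drop phi p in \<open>simp_all add: Bi split: option.splits\<close>)
        qed simp
      qed
    qed
  qed (use lenB in \<open>simp_all add: put_def eliminating_def\<close>)
  have "halts n f Eliminate s (1 + cost (Const 0) + cost (Const 0) + (1 + cost (Const 0) + cost (Const 0) +
    ((length B + 1) * (?t + cost (Var ''m'') + 15) + (1 + cost (Const 0) + cost (Var ''r'')))))
    (stores_points n (eliminate ?\<phi> None B))"
    unfolding Eliminate_def
  proof (rule halts_Assign_Seq, rule halts_Assign_Seq, rule halts_Seq, unfold val.simps, rule For, rule halts_Assign)
    fix s' assume "eliminating n ?\<phi> B (length B) s'"
    then show "stores_points n (eliminate ?\<phi> None B) (put s' ''m'' (val (Const 0) s') (val (Var ''r'') s'))"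
      unfolding eliminating_def stores_points_def using lenB by (auto simp: put_def)
  qed
  moreover have "(length B + 1) * (?t + cost (Var ''m'') + 15) \<le> (n + 1) * (250 * (n + 1) ^ 2 + 200 * (n + 1))"
    using lenB by (intro mult_mono) auto
  hence "1 + cost (Const 0) + cost (Const 0) + (1 + cost (Const 0) + cost (Const 0) +
    ((length B + 1) * (?t + cost (Var ''m'') + 15) + (1 + cost (Const 0) + cost (Var ''r''))))
     \<le> 500 * (n + 1) ^ 3" by (simp add: algebra_simps power2_eq_square power3_eq_cube)
  ultimately show ?thesis by (rule halts_weaken)
qed

section \<open>Extending the list of index sets and imposing the new equations\<close>

lemma stores_sets_snoc:
  assumes L: "stores_sets n v L s" and T: "T \<subseteq> {..<n}" and len: "length L < n"
    and "s' ''l'' 0 = Suc (length L)"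
    and z: "s' ''z'' = (s ''z'')(length L := card T)"
    and M: "\<forall>j<n. s' ''M'' (length L * n + j) = of_bool (j \<in> T)"
      "\<forall>i. i \<notin> {length L * n..<length L * n + n} \<longrightarrow> s' ''M'' i = s ''M'' i"
    and w: "\<forall>j<n. s' ''w'' (length L * n + j) = g j"
      "\<forall>i. i \<notin> {length L * n..<length L * n + n} \<longrightarrow> s' ''w'' i = s ''w'' i"
    and g: "read_point n g = (\<Sum>i\<in>T. v i)"
  shows "stores_sets n v (L @ [T]) s'"
  unfolding stores_sets_def
proof (intro conjI allI impI)
  fix t assume t: "t < length (L @ [T])"
  show "(L @ [T]) ! t \<subseteq> {..<n}" "s' ''z'' t = card ((L @ [T]) ! t)"
    using t L T z by (auto simp: stores_sets_def nth_append less_Suc_eq)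
  show "blk n (s' ''w'') t = (\<Sum>i\<in>(L @ [T]) ! t. v i)"
    using t L blk_write[OF w] g by (auto simp: stores_sets_def nth_append less_Suc_eq)
  fix i assume i: "i < n"
  show "s' ''M'' (t * n + i) = of_bool (i \<in> (L @ [T]) ! t)"
  proof (cases "t = length L")
    case True
    then show ?thesis using M(1) i by simp
  next
    case False
    then show ?thesis using M(2) block_index_notin[OF i False] t i L
      by (simp add: stores_sets_def nth_append)
  qed
qed (use assms in auto)

definition new_sets :: "nat \<Rightarrow> nat \<Rightarrow> nat set list \<Rightarrow> nat set list" where
  "new_sets d k Ls = map (insert k) (filter (\<lambda>T. card T < d - 1) Ls)"

text \<open>\<open>2 * length Ls \<le> n\<close> provides the room: each old set yields at most one
  new set, so during the loop the next free row has index below \<open>n\<close>.\<close>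

lemma halts_Extend:
  assumes s: "multiples n s" "s ''d'' 0 = d" "s ''k'' 0 = k" "k < n" "s ''c'' 0 = length Ls"
      "s ''m'' 0 = m" "m < n"
    and Ls: "stores_sets n v Ls s" "2 * length Ls \<le> n" "\<And>T. T \<in> set Ls \<Longrightarrow> k \<notin> T"
    and vk: "v k = blk n (s ''b'') m"
  shows "halts n f Extend s (300 * (n + 1) ^ 2) (stores_sets n v (Ls @ new_sets d k Ls))"
proof -
  define L where "L i = Ls @ new_sets d k (take i Ls)" for i
  let ?e1 = "Block ''M'' (Var ''s'')" and ?e2 = "Add (Block ''w'' (Var ''s'')) (Block ''b'' (Var ''m''))"
  let ?A1 = "Assign ''M'' (Add (Cell ''u'' (Var ''l'')) (Var ''k'')) (Const 1)"
  let ?A2 = "Assign ''z'' (Var ''l'') (Add (Cell ''z'' (Var ''s'')) (Const 1))"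
  let ?A3 = "Set ''l'' (Add (Var ''l'') (Const 1))"
  let ?F1 = "Fill ''M'' (Cell ''u'' (Var ''l'')) ?e1" and ?F2 = "Fill ''w'' (Cell ''u'' (Var ''l'')) ?e2"
  let ?g = "Sub (Sub (Var ''d'') (Const 1)) (Cell ''z'' (Var ''s''))"
  let ?P = "If ?g (Seq ?F1 (Seq ?F2 (Seq ?A1 (Seq ?A2 ?A3)))) Skip"
  let ?T = "(n + 1) * (cost (Cell ''u'' (Var ''l'')) + cost ?e1 + 25) +
    ((n + 1) * (cost (Cell ''u'' (Var ''l'')) + cost ?e2 + 25) +
    (1 + cost (Add (Cell ''u'' (Var ''l'')) (Var ''k'')) + cost (Const 1) +
    (1 + cost (Var ''l'') + cost (Add (Cell ''z'' (Var ''s'')) (Const 1)) +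
    (1 + cost (Const 0) + cost (Add (Var ''l'') (Const 1))))))"
  let ?t = "1 + cost ?g + max ?T 1"
  have len: "length Ls \<le> n" "\<And>i. i \<le> length Ls \<Longrightarrow> length (L i) \<le> length Ls + i"
    using Ls by (auto simp: L_def new_sets_def intro: le_trans[OF length_filter_le])
  have "halts n f Extend s ((length Ls + 1) * (?t + cost (Var ''c'') + 15))
      (stores_sets n v (L (length Ls)))"
    unfolding Extend_def
  proof (rule halts_For[where I = "\<lambda>i. stores_sets n v (L i)"])
    show "stores_sets n v (L 0) s'" if "\<And>y. y \<noteq> ''s'' \<Longrightarrow> s' y = s y" for s'
      using Ls that by (simp add: stores_sets_def L_def new_sets_def)
    show "stores_sets n v (L i) (put s ''s'' 0 k)" if "stores_sets n v (L i) s" for i s k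
      using that by (simp add: stores_sets_def put_def)
    fix i s' assume i: "i < length Ls" "s' ''s'' 0 = i" and inv: "stores_sets n v (L i) s'"
      and fr: "\<And>y. y \<notin> insert ''s'' (writes ?P) \<Longrightarrow> s' y = s y"
    have eqs: "s' ''u'' = s ''u''" "s' ''n'' = s ''n''" "s' ''d'' = s ''d''" "s' ''k'' = s ''k''"
      "s' ''m'' = s ''m''" "s' ''b'' = s ''b''"
      using fr by simp_all
    have m': "multiples n s'" using s(1) eqs by (simp add: multiples_def)
    define T where "T = Ls ! i"
    have T: "T = L i ! i" "i < length (L i)" using i by (simp_all add: T_def L_def nth_append)
    then have Ti: "T \<subseteq> {..<n}" "s' ''z'' i = card T" "blk n (s' ''w'') i = (\<Sum>i\<in>T. v i)"
      "\<And>j. j < n \<Longrightarrow> s' ''M'' (i * n + j) = of_bool (j \<in> T)"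
      using inv by (simp_all add: stores_sets_def)
    have kT: "k \<notin> T" "finite T" using Ls(3) i Ti(1) by (auto simp: T_def intro: finite_subset)
    have l: "s' ''l'' 0 = length (L i)" "length (L i) < n"
      using inv len(2)[of i] i Ls(2) by (simp_all add: stores_sets_def)
    have LS: "L (Suc i) = L i @ (if card T < d - 1 then [insert k T] else [])"
      using i by (simp add: L_def new_sets_def take_Suc_conv_app_nth T_def)
    have i_n: "i < n" using i len by simp
    show "halts n f ?P s' ?t (stores_sets n v (L (Suc i)))"
    proof (rule halts_If)
      assume "val ?g s' = 0"
      then have "L (Suc i) = L i" using LS i eqs s Ti by simp
      with inv show "halts n f Skip s' 1 (stores_sets n v (L (Suc i)))"
        by (intro halts_Skip) simp
    next
      assume "val ?g s' \<noteq> 0"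
      then have "card T < d - 1" using i eqs s Ti by simp
      then have LS': "L (Suc i) = L i @ [insert k T]" using LS by simp
      let ?b = "length (L i) * n"
      \<comment> \<open>The source row \<open>i\<close> precedes the free row, so copying never
        reads a cell that it has overwritten.\<close>
      have below: "\<not> ?b \<le> i * n + j" if "j < n" for j
        using that T(2) mult_le_mono1[of "Suc i" "length (L i)" n] by simp
      show "halts n f (Seq ?F1 (Seq ?F2 (Seq ?A1 (Seq ?A2 ?A3)))) s' ?T (stores_sets n v (L (Suc i)))"
      proof (rule halts_Seq, rule halts_Fill)
        fix s1 assume M: "(\<forall>j<n. s1 ''M'' (?b + j) = of_bool (j \<in> T)) \<and>
            (\<forall>i. i \<notin> {?b..<?b + n} \<longrightarrow> s1 ''M'' i = s' ''M'' i)"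
          and fr1: "\<And>y. y \<notin> writes ?F1 \<Longrightarrow> s1 y = s' y"
        let ?g = "\<lambda>j. s' ''w'' (i * n + j) + s ''b'' (m * n + j)"
        show "halts n f (Seq ?F2 (Seq ?A1 (Seq ?A2 ?A3))) s1
          ((n + 1) * (cost (Cell ''u'' (Var ''l'')) + cost ?e2 + 25) +
          (1 + cost (Add (Cell ''u'' (Var ''l'')) (Var ''k'')) + cost (Const 1) +
          (1 + cost (Var ''l'') + cost (Add (Cell ''z'' (Var ''s'')) (Const 1)) +
          (1 + cost (Const 0) + cost (Add (Var ''l'') (Const 1))))))
          (stores_sets n v (L (Suc i)))"
        proof (rule halts_Seq, rule halts_Fill)
          fix s2 assume w: "(\<forall>j<n. s2 ''w'' (?b + j) = ?g j) \<and>
              (\<forall>i. i \<notin> {?b..<?b + n} \<longrightarrow> s2 ''w'' i = s1 ''w'' i)"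
            and fr2: "\<And>y. y \<notin> writes ?F2 \<Longrightarrow> s2 y = s1 y"
          have eqs2: "s2 ''l'' 0 = length (L i)" "s2 ''M'' = s1 ''M''" "s2 ''z'' = s' ''z''"
              "s2 ''u'' = s' ''u''" "s2 ''k'' = s' ''k''" "s2 ''s'' = s' ''s''"
            using fr1 fr2 l by simp_all
          have u: "s' ''u'' (length (L i)) = ?b" using m' l by (simp add: multiples_def)
          \<comment> \<open>The copied row gets its bit \<open>k\<close> afterwards;
            \<open>k < n\<close> keeps that cell inside the row.\<close>
          have M': "\<forall>j<n. ((s1 ''M'')(?b + k := 1)) (?b + j) = of_bool (j \<in> insert k T)"
            "\<forall>i. i \<notin> {?b..<?b + n} \<longrightarrow> ((s1 ''M'')(?b + k := 1)) i = s' ''M'' i"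
            using M s(4) by auto
          have "read_point n ?g = (\<Sum>i\<in>insert k T. v i)"
            unfolding read_point_add using Ti(3) kT vk by (simp add: blk_def add.commute)
          then have "stores_sets n v (L (Suc i)) (put (put (put s2 ''M'' (?b + k) 1)
              ''z'' (length (L i)) (card T + 1)) ''l'' 0 (length (L i) + 1))"
            unfolding LS' using kT M' w fr1 Ti(1) s(4)
            by (intro stores_sets_snoc[OF inv _ l(2), where g = ?g])
              (simp_all add: put_def eqs2)
          with eqs2 eqs s u i Ti show "halts n f (Seq ?A1 (Seq ?A2 ?A3)) s2
            (1 + cost (Add (Cell ''u'' (Var ''l'')) (Var ''k'')) + cost (Const 1) +
            (1 + cost (Var ''l'') + cost (Add (Cell ''z'' (Var ''s'')) (Const 1)) +
            (1 + cost (Const 0) + cost (Add (Var ''l'') (Const 1)))))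
            (stores_sets n v (L (Suc i)))"
            by (intro halts_Assign_Seq halts_Assign) (simp add: put_def)
        qed (use m' l i i_n s eqs fr1 below in \<open>simp_all add: multiples_def\<close>)
      qed (use m' l i i_n Ti(4) below in \<open>simp_all add: multiples_def\<close>)
    qed
  qed (use s in simp_all)
  then have "halts n f Extend s ((length Ls + 1) * (?t + cost (Var ''c'') + 15))
      (stores_sets n v (Ls @ new_sets d k Ls))" by (simp only: L_def take_all order_refl)
  then show ?thesis
  proof (rule halts_weaken)
    have "(length Ls + 1) * (?t + cost (Var ''c'') + 15) \<le> (n + 1) * (300 * (n + 1))"
      using len by (intro mult_mono) auto
    then show "(length Ls + 1) * (?t + cost (Var ''c'') + 15) \<le> 300 * (n + 1) ^ 2"
      by (simp add: power2_eq_square algebra_simps)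
  qed
qed

definition eliminate_top :: "(point \<Rightarrow> bit) \<Rightarrow> nat \<Rightarrow> (nat \<Rightarrow> point) \<Rightarrow> point list \<Rightarrow> nat set list \<Rightarrow> point list" where
  "eliminate_top f d v = foldl (\<lambda>B T. if card T = d - 1 then eliminate (deriv f v T) None B else B)"

lemma eliminate_top_snoc:
  "eliminate_top f d v B (N @ [T]) = (if card T = d - 1
    then eliminate (deriv f v T) None (eliminate_top f d v B N) else eliminate_top f d v B N)"
  by (simp add: eliminate_top_def)

lemma halts_Eliminate_New:
  assumes s: "multiples n s" "s ''d'' 0 = d" "s ''c'' 0 = length Ls"
    and Ls: "stores_sets n v (Ls @ N) s" "distinct (Ls @ N)"
      "set (Ls @ N) = {T. T \<subseteq> A \<and> card T \<le> d - 1}" "finite A"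
    and B: "stores_points n B s"
  shows "halts n f Eliminate_New s (600 * (n + 1) ^ 4) (stores_points n (eliminate_top f d v B N))"
proof -
  let ?g = "Sub (Var ''d'') (Add (Cell ''z'' (Var ''t'')) (Const 1))"
  let ?P = "Seq (Set ''t'' (Add (Var ''c'') (Var ''x''))) (If ?g Skip Eliminate)"
  let ?t = "1 + cost (Const 0) + cost (Add (Var ''c'') (Var ''x'')) +
    (1 + cost ?g + max 1 (500 * (n + 1) ^ 3))"
  have len: "length Ls + length N \<le> n" using Ls by (simp add: stores_sets_def)
  have "halts n f Eliminate_New s ((length N + 1) * (?t + cost (Sub (Var ''l'') (Var ''c'')) + 15))
      (stores_points n (eliminate_top f d v B (take (length N) N)))"
    unfolding Eliminate_New_def
  proof (rule halts_For[where I = "\<lambda>i. stores_points n (eliminate_top f d v B (take i N))"])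
    show "val (Sub (Var ''l'') (Var ''c'')) s' = length N"
      if "\<And>y. y \<notin> insert ''x'' (writes ?P) \<Longrightarrow> s' y = s y" for s'
      using that Ls s by (simp add: stores_sets_def)
    show "stores_points n (eliminate_top f d v B (take 0 N)) s'"
      if "\<And>y. y \<noteq> ''x'' \<Longrightarrow> s' y = s y" for s'
      using that B by (simp add: stores_points_def eliminate_top_def)
    fix i s' assume i: "i < length N" "s' ''x'' 0 = i"
      and inv: "stores_points n (eliminate_top f d v B (take i N)) s'"
      and fr: "\<And>y. y \<notin> insert ''x'' (writes ?P) \<Longrightarrow> s' y = s y"
    let ?s = "put s' ''t'' 0 (length Ls + i)"
    have eqs: "s' ''c'' = s ''c''" "s' ''d'' = s ''d''" "s' ''z'' = s ''z''" "s' ''u'' = s ''u''"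
      "s' ''n'' = s ''n''" "s' ''l'' = s ''l''" "s' ''M'' = s ''M''" "s' ''w'' = s ''w''"
      using fr by simp_all
    have m': "multiples n ?s" and Ls': "stores_sets n v (Ls @ N) ?s"
      and inv': "stores_points n (eliminate_top f d v B (take i N)) ?s"
      using s(1) Ls(1) inv eqs by (simp_all add: multiples_def stores_sets_def stores_points_def put_def)
    define T where "T = N ! i"
    have T: "T = (Ls @ N) ! (length Ls + i)" by (simp add: T_def)
    have "T \<in> set (Ls @ N)" using i by (simp add: T_def)
    then have TA: "T \<subseteq> A" "card T \<le> d - 1" unfolding Ls(3) by simp_all
    have z: "?s ''z'' (length Ls + i) = card T"
      using Ls' i T by (simp add: stores_sets_def)
    \<comment> \<open>Closure under subsets is the reason for storing all sizes up to
      \<open>d - 1\<close>: a derivative needs the point of every subset of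
      \<open>T\<close>.\<close>
    have Pow: "Pow T \<subseteq> set (Ls @ N)"
      unfolding Ls(3) using TA card_mono[OF finite_subset[OF TA(1) Ls(4)]]
      by (auto intro: order_trans)
    have take: "take (Suc i) N = take i N @ [T]" using i by (simp add: T_def take_Suc_conv_app_nth)
    show "halts n f ?P s' ?t (stores_points n (eliminate_top f d v B (take (Suc i) N)))"
    proof (rule halts_Assign_Seq)
      have "put s' ''t'' (val (Const 0) s') (val (Add (Var ''c'') (Var ''x'')) s') = ?s"
        using s i eqs by simp
      moreover have "halts n f (If ?g Skip Eliminate) ?s (1 + cost ?g + max 1 (500 * (n + 1) ^ 3))
          (stores_points n (eliminate_top f d v B (take (Suc i) N)))"
      proof (rule halts_If)
        assume "val ?g ?s \<noteq> 0"
        then have "card T \<noteq> d - 1" using z s eqs by (simp add: put_def)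
        then show "halts n f Skip ?s 1 (stores_points n (eliminate_top f d v B (take (Suc i) N)))"
          using inv' by (intro halts_Skip) (simp add: take eliminate_top_snoc)
      next
        assume "val ?g ?s = 0"
        then have "card T = d - 1" using z s eqs TA(2) by (simp add: put_def)
        then have "eliminate_top f d v B (take (Suc i) N) =
            eliminate (deriv f v ((Ls @ N) ! (length Ls + i))) None (eliminate_top f d v B (take i N))"
          by (simp add: take eliminate_top_snoc T_def)
        moreover have "halts n f Eliminate ?s (500 * (n + 1) ^ 3) (stores_points n
            (eliminate (deriv f v ((Ls @ N) ! (length Ls + i))) None (eliminate_top f d v B (take i N))))"
          by (rule halts_Eliminate[OF m' _ _ Ls' Ls(2) _ inv']) (use i Pow T in \<open>simp_all add: put_def\<close>)
        ultimately show "halts n f Eliminate ?s (500 * (n + 1) ^ 3)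
            (stores_points n (eliminate_top f d v B (take (Suc i) N)))" by simp
      qed
      ultimately show "halts n f (If ?g Skip Eliminate)
          (put s' ''t'' (val (Const 0) s') (val (Add (Var ''c'') (Var ''x'')) s'))
          (1 + cost ?g + max 1 (500 * (n + 1) ^ 3))
          (stores_points n (eliminate_top f d v B (take (Suc i) N)))" by simp
    qed
  qed (simp_all add: stores_points_def put_def)
  then have "halts n f Eliminate_New s ((length N + 1) * (?t + cost (Sub (Var ''l'') (Var ''c'')) + 15))
      (stores_points n (eliminate_top f d v B N))" by (simp only: take_all order_refl)
  then show ?thesis
  proof (rule halts_weaken)
    obtain n3 where n3: "(n + 1) ^ 3 = n3" "1 \<le> n3" by simp
    have "?t + cost (Sub (Var ''l'') (Var ''c'')) + 15 \<le> 600 * (n + 1) ^ 3"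
      unfolding n3(1) cost.simps using n3(2) by linarith
    moreover have "length N + 1 \<le> n + 1" using len by linarith
    ultimately have "(length N + 1) * (?t + cost (Sub (Var ''l'') (Var ''c'')) + 15)
        \<le> (n + 1) * (600 * (n + 1) ^ 3)"
      by (intro mult_le_mono)
    also have "\<dots> = 600 * (n + 1) ^ 4" using power_add[of "n + 1" 1 3] by simp
    finally show "(length N + 1) * (?t + cost (Sub (Var ''l'') (Var ''c'')) + 15) \<le> 600 * (n + 1) ^ 4" .
  qed
qed

section \<open>One round of the main loop, and the initial state\<close>

definition stores :: "nat \<Rightarrow> nat \<Rightarrow> nat \<Rightarrow> (nat \<Rightarrow> point) \<Rightarrow> nat set list \<Rightarrow> point list \<Rightarrow> state \<Rightarrow> bool" where
  "stores n d k v Ls B s \<longleftrightarrow> multiples n s \<and> s ''d'' 0 = d \<and> s ''k'' 0 = k \<and> s ''out'' 0 = k \<and>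
    out_block n s 0 = 0 \<and> (\<forall>i\<in>{1..k}. out_block n s i = v i) \<and>
    stores_sets n v Ls s \<and> stores_points n B s"

lemma halts_Step:
  assumes st: "stores n d k v Ls (B @ [b]) s"
    and Ls: "set Ls = {T. T \<subseteq> {1..k} \<and> card T \<le> d - 1}" "k + 1 \<le> length Ls" "2 * length Ls \<le> n"
    and N: "N = new_sets d (Suc k) Ls" "distinct (Ls @ N)"
      "set (Ls @ N) = {T. T \<subseteq> {1..Suc k} \<and> card T \<le> d - 1}"
    and v': "v' = v(Suc k := b)"
  shows "halts n f Step s (1000 * (n + 1) ^ 4)
    (stores n d (Suc k) v' (Ls @ N) (eliminate_top f d v' B N))"
proof -
  have s: "multiples n s" "s ''d'' 0 = d" "s ''k'' 0 = k" "out_block n s 0 = 0"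
      "\<And>i. i \<in> {1..k} \<Longrightarrow> out_block n s i = v i" "stores_sets n v Ls s" "stores_points n (B @ [b]) s"
    using st by (simp_all add: stores_def)
  \<comment> \<open>This is where \<open>k + 1 \<le> length Ls\<close> enters: together with
    \<open>2 * length Ls \<le> n\<close> it keeps the new index inside rows and lookup
    table.\<close>
  have kn: "Suc k < n" using Ls by simp
  let ?m = "length B"
  have m: "?m < n" "s ''m'' 0 = Suc ?m" "blk n (s ''b'') ?m = b"
      and B: "\<And>i. i < ?m \<Longrightarrow> blk n (s ''b'') i = B ! i"
    using s(7) by (auto simp: stores_points_def nth_append all_conj_distrib)
  let ?s = "put (put (put s ''m'' 0 ?m) ''k'' 0 (Suc k)) ''out'' 0 (Suc k)"
  let ?F = "Fill ''out'' (Add (Const 1) (Cell ''u'' (Var ''k''))) (Block ''b'' (Var ''m''))"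
  let ?o = "1 + Suc k * n"
  have "halts n f Step s
   (1 + cost (Const 0) + cost (Sub (Var ''m'') (Const 1)) +
   (1 + cost (Const 0) + cost (Add (Var ''k'') (Const 1)) +
   (1 + cost (Const 0) + cost (Var ''k'') +
   ((n + 1) * (cost (Add (Const 1) (Cell ''u'' (Var ''k''))) + cost (Block ''b'' (Var ''m'')) + 25) +
   (1 + cost (Const 0) + cost (Var ''l'') + (300 * (n + 1) ^ 2 + 600 * (n + 1) ^ 4))))))
   (stores n d (Suc k) v' (Ls @ N) (eliminate_top f d v' B N))"
    unfolding Step_def
  proof (rule halts_Assign_Seq_eval[where a = 0 and b = ?m], goal_cases)
    case 3
    show ?case
    proof (rule halts_Assign_Seq_eval[where a = 0 and b = "Suc k"], goal_cases)
      case 3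
      show ?case
      proof (rule halts_Assign_Seq_eval[where a = 0 and b = "Suc k"], goal_cases)
        case 3
        show ?case
        proof (rule halts_Seq)
          show "halts n f ?F ?s
            ((n + 1) * (cost (Add (Const 1) (Cell ''u'' (Var ''k''))) + cost (Block ''b'' (Var ''m'')) + 25))
            (\<lambda>s'. (\<forall>j<n. s' ''out'' (?o + j) = s ''b'' (?m * n + j)) \<and>
              (\<forall>i. i \<notin> {?o..<?o + n} \<longrightarrow> s' ''out'' i = ?s ''out'' i))"
            by (rule halts_Fill) (use s kn m in \<open>simp_all add: multiples_def put_def\<close>)
          fix s1 assume out: "(\<forall>j<n. s1 ''out'' (?o + j) = s ''b'' (?m * n + j)) \<and>
              (\<forall>i. i \<notin> {?o..<?o + n} \<longrightarrow> s1 ''out'' i = ?s ''out'' i)"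
            and fr1: "\<And>y. y \<notin> writes ?F \<Longrightarrow> s1 y = ?s y"
          have out0: "s1 ''out'' 0 = Suc k" using out by (simp add: put_def)
          have new: "out_block n s1 (Suc k) = b"
            unfolding out_block_def m(3)[symmetric] blk_def
            using out by (intro read_point_cong) simp
          have old: "out_block n s1 i = out_block n s i" if "i \<noteq> Suc k" for i
            unfolding out_block_def
          proof (rule read_point_cong)
            fix j assume "j < n"
            then have "1 + i * n + j \<notin> {?o..<?o + n}"
              using block_index_notin[OF _ that] by auto
            then show "s1 ''out'' (1 + i * n + j) = s ''out'' (1 + i * n + j)"
              using out by (simp add: put_def)
          qed
          let ?s1 = "put s1 ''c'' 0 (length Ls)"
          have fr: "?s1 y = s y" if "y \<notin> {''m'', ''k'', ''out'', ''c'', ''j''}" for y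
            using that fr1 by (simp add: put_def)
          have sc: "?s1 ''k'' 0 = Suc k" "?s1 ''m'' 0 = ?m" "?s1 ''c'' 0 = length Ls"
            using fr1 by (simp_all add: put_def)
          have notin: "Suc k \<notin> T" if "T \<in> set Ls" for T
            using that unfolding Ls(1) by auto
          \<comment> \<open>Old sets avoid the new index, so the points stored for them stay correct
            under \<open>v'\<close>.\<close>
          have "(\<Sum>i\<in>T. v' i) = (\<Sum>i\<in>T. v i)" if "T \<in> set Ls" for T
            using notin[OF that] unfolding v' by (intro sum.cong) auto
          then have sets: "stores_sets n v' Ls ?s1"
            using s(6) fr unfolding stores_sets_def by simp
          have mult: "multiples n ?s1" using s(1) fr by (simp add: multiples_def)
          show "halts n f (Seq (Set ''c'' (Var ''l'')) (Seq Extend Eliminate_New)) s1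
            (1 + cost (Const 0) + cost (Var ''l'') + (300 * (n + 1) ^ 2 + 600 * (n + 1) ^ 4))
            (stores n d (Suc k) v' (Ls @ N) (eliminate_top f d v' B N))"
          proof (rule halts_Assign_Seq_eval[where a = 0 and b = "length Ls"], goal_cases)
            case 3
            show ?case
            proof (rule halts_Seq)
              show "halts n f Extend ?s1 (300 * (n + 1) ^ 2) (stores_sets n v' (Ls @ N))"
                unfolding N(1)
                by (rule halts_Extend[OF mult _ sc(1) kn sc(3,2) m(1) sets Ls(3) notin])
                  (use fr s m v' in simp_all)
              fix s2 assume sets2: "stores_sets n v' (Ls @ N) s2"
                and fr2: "\<And>y. y \<notin> writes Extend \<Longrightarrow> s2 y = ?s1 y"
              have mult2: "multiples n s2" using mult fr2 by (simp add: multiples_def)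
              have sc2: "s2 ''d'' 0 = d" "s2 ''c'' 0 = length Ls" "s2 ''k'' 0 = Suc k"
                  "s2 ''out'' = s1 ''out''"
                using fr2 sc fr s by (simp_all add: put_def)
              have "stores_points n B s2"
                using m B fr2 fr sc by (simp add: stores_points_def)
              from halts_Eliminate_New[OF mult2 sc2(1,2) sets2 N(2,3) _ this]
              have "halts n f Eliminate_New s2 (600 * (n + 1) ^ 4)
                  (stores_points n (eliminate_top f d v' B N))"
                by simp
              then show "halts n f Eliminate_New s2 (600 * (n + 1) ^ 4)
                  (stores n d (Suc k) v' (Ls @ N) (eliminate_top f d v' B N))"
              proof (rule halts_weaken)
                fix s3 assume pts: "stores_points n (eliminate_top f d v' B N) s3"
                  and fr3: "\<And>y. y \<notin> writes Eliminate_New \<Longrightarrow> s3 y = s2 y"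
                have "stores_sets n v' (Ls @ N) s3" "multiples n s3"
                  using sets2 mult2 fr3 by (simp_all add: stores_sets_def multiples_def)
                moreover have "out_block n s3 i = out_block n s1 i" for i
                  using fr3 sc2 by (simp add: out_block_def)
                moreover have "out_block n s1 i = v' i" if "i \<in> {1..Suc k}" for i
                  using that new old[of i] s(5)[of i] v' by (cases "i = Suc k") auto
                moreover have "out_block n s1 0 = 0" using old[of 0] s(4) by simp
                ultimately show "stores n d (Suc k) v' (Ls @ N) (eliminate_top f d v' B N) s3"
                  using pts sc2 fr3 out0 by (simp add: stores_def)
              qed simp
            qed
          qed (use fr[of "''l''"] s(6) in \<open>simp_all add: put_def stores_sets_def\<close>)
        qed
      qed (simp_all add: put_def)
    qed (use s in \<open>simp_all add: put_def\<close>)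
  qed (use m in simp_all)
  then show ?thesis
  proof (rule halts_weaken)
    have "(n + 1) ^ 1 \<le> (n + 1) ^ 4" "(n + 1) ^ 2 \<le> (n + 1) ^ 4"
      by (rule power_increasing; simp)+
    then obtain n4 where "(n + 1) ^ 4 = n4" "n + 1 \<le> n4" "(n + 1) ^ 2 \<le> n4" by simp
    then show "1 + cost (Const 0) + cost (Sub (Var ''m'') (Const 1)) +
      (1 + cost (Const 0) + cost (Add (Var ''k'') (Const 1)) +
      (1 + cost (Const 0) + cost (Var ''k'') +
      ((n + 1) * (cost (Add (Const 1) (Cell ''u'' (Var ''k''))) + cost (Block ''b'' (Var ''m'')) + 25) +
      (1 + cost (Const 0) + cost (Var ''l'') + (300 * (n + 1) ^ 2 + 600 * (n + 1) ^ 4)))))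
       \<le> 1000 * (n + 1) ^ 4" by simp
  qed
qed

definition unit_point :: "nat \<Rightarrow> point" where
  "unit_point i = (\<lambda>j. of_bool (j = i))"

lemma halts_Init:
  assumes "0 < n"
  shows "halts n f Init (input_state n d) (100 * (n + 1))
    (stores n d 0 (\<lambda>_. 0) [{}] (map unit_point [0..<n]))"
proof -
  let ?s = "put (put (input_state n d) ''m'' 0 n) ''l'' 0 1"
  let ?P = "Seq (Assign ''b'' (Add (Cell ''u'' (Var ''i'')) (Var ''i'')) (Const 1))
      (Assign ''u'' (Add (Var ''i'') (Const 1)) (Add (Cell ''u'' (Var ''i'')) (Var ''n'')))"
  let ?t = "1 + cost (Add (Cell ''u'' (Var ''i'')) (Var ''i'')) + cost (Const 1) +
    (1 + cost (Add (Var ''i'') (Const 1)) + cost (Add (Cell ''u'' (Var ''i'')) (Var ''n'')))"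
  let ?I = "\<lambda>i s. (\<forall>t\<le>i. s ''u'' t = t * n) \<and>
    (\<forall>t j. j < n \<longrightarrow> s ''b'' (t * n + j) = of_bool (t < i \<and> j = t))"
  have For: "halts n f (For ''i'' (Var ''n'') ?P) ?s ((n + 1) * (?t + cost (Var ''n'') + 15)) (?I n)"
  proof (rule halts_For[where I = ?I])
    fix i s' assume i: "i < n" "s' ''i'' 0 = i" and inv: "?I i s'"
      and fr: "\<And>y. y \<notin> insert ''i'' (writes ?P) \<Longrightarrow> s' y = ?s y"
    have n: "s' ''n'' 0 = n" using fr[of "''n''"] by (simp add: put_def input_state_def)
    have iff: "t * n + j = i * n + i \<longleftrightarrow> t = i \<and> j = i" if "j < n" for t j
      using block_index_eq_iff that i(1) by blast
    show "halts n f ?P s' ?t (?I (Suc i))"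
    proof (rule halts_Assign_Seq_eval[where a = "i * n + i" and b = 1], goal_cases)
      case 3
      show ?case
        by (rule halts_Assign) (use i inv n iff in \<open>auto simp: put_def le_Suc_eq less_Suc_eq\<close>)
    qed (use i inv in simp_all)
  qed (simp_all add: put_def input_state_def)
  let ?J = "\<lambda>s'. ?I n s' \<and> (\<forall>y. y \<notin> {''i'', ''b'', ''u''} \<longrightarrow> s' y = ?s y)"
  have For': "halts n f (For ''i'' (Var ''n'') ?P) ?s ((n + 1) * (?t + cost (Var ''n'') + 15)) ?J"
    by (rule halts_weaken[OF For]) auto
  have "halts n f Init (input_state n d)
    (1 + cost (Const 0) + cost (Var ''n'') + (1 + cost (Const 0) + cost (Const 1) +
      ((n + 1) * (?t + cost (Var ''n'') + 15)))) ?J"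
    unfolding Init_def
  proof (rule halts_Assign_Seq_eval[where a = 0 and b = n], goal_cases)
    case 3
    show ?case by (rule halts_Assign_Seq_eval[where a = 0 and b = 1, OF _ _ For']) simp_all
  qed (simp_all add: put_def input_state_def)
  then show ?thesis
  proof (rule halts_weaken)
    fix s assume J: "?J s"
    then have fr: "s ''n'' 0 = n" "s ''d'' 0 = d" "s ''k'' 0 = 0" "s ''m'' 0 = n" "s ''l'' 0 = 1"
      "s ''out'' = (\<lambda>_. 0)" "s ''M'' = (\<lambda>_. 0)" "s ''w'' = (\<lambda>_. 0)" "s ''z'' = (\<lambda>_. 0)"
      by (simp_all add: put_def input_state_def)
    have zero: "read_point n (\<lambda>j. 0) = 0" by (auto simp: read_point_def)
    have "blk n (s ''b'') i = unit_point i" if "i < n" for i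
      using that J by (auto simp: blk_def read_point_def unit_point_def fun_eq_iff)
    then show "stores n d 0 (\<lambda>_. 0) [{}] (map unit_point [0..<n]) s"
      using fr J assms
      by (simp add: stores_def multiples_def out_block_def zero stores_sets_def stores_points_def blk_def)
  qed (simp add: algebra_simps)
qed

section \<open>Low-degree functions\<close>

text \<open>By default the simplifier turns field operations on type \<open>bit\<close> into Boolean ones.\<close>

declare add_bit_eq_xor [simp del] mult_bit_eq_and [simp del]

lemma bit_add_self [simp]: "a + a = 0" for a :: bit
  by (cases a) simp_all

text \<open>Sums of monomials, repetitions allowed, seen as functions. Closure properties then
  follow by induction without coefficients; \<open>lowdeg_mleval\<close> and
  \<open>lowdeg_imp_mleval\<close> link this to \<open>mlpoly\<close>.\<close>

inductive lowdeg :: "nat \<Rightarrow> nat \<Rightarrow> (point \<Rightarrow> bit) \<Rightarrow> bool" for n k where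
  zero: "lowdeg n k (\<lambda>_. 0)"
| add: "lowdeg n k g \<Longrightarrow> S \<subseteq> {..<n} \<Longrightarrow> card S \<le> k \<Longrightarrow> lowdeg n k (\<lambda>x. (\<Prod>i\<in>S. x i) + g x)"

lemma lowdeg_monomial: "S \<subseteq> {..<n} \<Longrightarrow> card S \<le> k \<Longrightarrow> lowdeg n k (\<lambda>x. \<Prod>i\<in>S. x i)"
  using lowdeg.add[OF lowdeg.zero] by simp

lemma lowdeg_add:
  assumes "lowdeg n k g" "lowdeg n k h"
  shows "lowdeg n k (\<lambda>x. g x + h x)"
  using assms(1)
proof induction
  case zero
  then show ?case using assms(2) by simp
next
  case (add g S)
  then show ?case using lowdeg.add[OF add.IH add.hyps(2,3)] by (simp add: add.assoc)
qed

lemma lowdeg_sum: "(\<And>i. i \<in> I \<Longrightarrow> lowdeg n k (g i)) \<Longrightarrow> lowdeg n k (\<lambda>x. \<Sum>i\<in>I. g i x)"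
  by (induction I rule: infinite_finite_induct) (auto intro: lowdeg.zero lowdeg_add)

lemma lowdeg_mono: "lowdeg n k g \<Longrightarrow> k \<le> k' \<Longrightarrow> lowdeg n k' g"
  by (induction rule: lowdeg.induct) (auto intro: lowdeg.intros)

lemma lowdeg_const: "lowdeg n k (\<lambda>_. c)"
  using lowdeg_monomial[of "{}" n k] lowdeg.zero by (cases c) simp_all

lemma lowdeg_scale: "lowdeg n k g \<Longrightarrow> lowdeg n k (\<lambda>x. c * g x)"
  using lowdeg.zero by (cases c) simp_all

text \<open>Since \<open>x i * x i = x i\<close>, multiplying a monomial by a coordinate enlarges
  its index set by at most one element.\<close>

lemma lowdeg_coordinate:
  assumes "lowdeg n k g" "i < n"
  shows "lowdeg n (Suc k) (\<lambda>x. x i * g x)"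
  using assms(1)
proof induction
  case zero
  then show ?case by (simp add: lowdeg.zero)
next
  case (add g S)
  have "finite S" using add.hyps(2) finite_subset by blast
  have eq: "x i * (\<Prod>i\<in>S. x i) = (\<Prod>i\<in>insert i S. x i)" for x :: point
  proof (cases "i \<in> S")
    case True
    have "x i * x i = x i" by (cases "x i") simp_all
    then show ?thesis using \<open>finite S\<close> True
      by (simp add: insert_absorb prod.remove[of S i] mult.assoc[symmetric])
  qed (simp add: \<open>finite S\<close>)
  have "insert i S \<subseteq> {..<n}" "card (insert i S) \<le> Suc k"
    using add.hyps assms(2) card_insert_le_m1[of "Suc k" S i] by auto
  from lowdeg.add[OF add.IH this] show ?case by (simp add: distrib_left eq)
qed

lemma lowdeg_linear_form:
  assumes "lowdeg n k g"
  shows "lowdeg n (Suc k) (\<lambda>x. (\<Sum>j<n. a j * x j) * g x)"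
proof -
  have "lowdeg n (Suc k) (\<lambda>x. \<Sum>j<n. a j * (x j * g x))"
    by (intro lowdeg_sum lowdeg_scale lowdeg_coordinate assms) auto
  then show ?thesis by (simp add: sum_distrib_right mult.assoc)
qed

lemma lowdeg_prod_linear_forms:
  "finite T \<Longrightarrow> lowdeg n (card T) (\<lambda>x. \<Prod>i\<in>T. \<Sum>j<n. a i j * x j)"
  by (induction T rule: finite_induct) (auto intro: lowdeg_const lowdeg_linear_form)

text \<open>With \<open>P\<close> and \<open>Q\<close> the two products over the smaller set, the
  difference is \<open>x i * (P + Q) + v i * Q\<close>; the induction hypothesis bounds
  \<open>P + Q\<close>, and \<open>Q = P + (P + Q)\<close>.\<close>

lemma lowdeg_monomial_difference:
  "finite S \<Longrightarrow> S \<subseteq> {..<n} \<Longrightarrow> lowdeg n (card S - 1) (\<lambda>x. (\<Prod>i\<in>S. x i) + (\<Prod>i\<in>S. x i + v i))"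
proof (induction S rule: finite_induct)
  case empty
  then show ?case by (simp add: lowdeg.zero)
next
  case (insert i S)
  let ?P = "\<lambda>x. \<Prod>i\<in>S. x i" and ?Q = "\<lambda>x. \<Prod>i\<in>S. x i + v i"
  have "lowdeg n (card S) (\<lambda>x. x i * (?P x + ?Q x) + v i * (?P x + (?P x + ?Q x)))"
  proof (intro lowdeg_add lowdeg_scale)
    show "lowdeg n (card S) (\<lambda>x. x i * (?P x + ?Q x))"
    \<comment> \<open>\<open>card S - 1\<close> truncates at \<open>S = {}\<close>, but there
      \<open>P + Q = 0\<close>.\<close>
    proof (cases "S = {}")
      case False
      then have "card S = Suc (card S - 1)" using insert.hyps by (simp add: card_gt_0_iff)
      then show ?thesis using lowdeg_coordinate[of n "card S - 1" _ i] insert by auto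
    qed (simp add: lowdeg.zero)
    show "lowdeg n (card S) ?P" using insert by (intro lowdeg_monomial) auto
    then show "lowdeg n (card S) ?P" .
    have "lowdeg n (card S) (\<lambda>x. ?P x + ?Q x)" using insert by (auto elim: lowdeg_mono)
    moreover have "lowdeg n (card S) (\<lambda>x. ?P x + (?P x + ?Q x))"
      by (rule lowdeg_add) fact+
    ultimately show "lowdeg n (card S) ?Q" by (simp add: add.assoc[symmetric])
  qed
  moreover have "(\<Prod>i\<in>insert i S. x i) + (\<Prod>i\<in>insert i S. x i + v i) =
      x i * (?P x + ?Q x) + v i * (?P x + (?P x + ?Q x))" for x
    using insert.hyps by (simp add: algebra_simps)
  ultimately show ?case using insert.hyps by simp
qed

lemma lowdeg_difference:
  assumes "lowdeg n k g"
  shows "lowdeg n (k - 1) (\<lambda>x. g x + g (x + v))"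
  using assms
proof induction
  case (add g S)
  have "finite S" using add.hyps(2) finite_subset by blast
  have "lowdeg n (k - 1) (\<lambda>x. ((\<Prod>i\<in>S. x i) + (\<Prod>i\<in>S. x i + v i)) + (g x + g (x + v)))"
  proof (rule lowdeg_add)
    show "lowdeg n (k - 1) (\<lambda>x. (\<Prod>i\<in>S. x i) + (\<Prod>i\<in>S. x i + v i))"
      by (rule lowdeg_mono[OF lowdeg_monomial_difference[OF \<open>finite S\<close> add.hyps(2)]])
        (use add.hyps(3) in simp)
  qed (rule add.IH)
  then show ?case by (simp add: algebra_simps plus_fun_def)
qed (simp add: lowdeg.zero)

text \<open>The case in which \<open>lowdeg_difference\<close> shows no drop, because
  \<open>k - 1\<close> truncates: a function of degree \<open>0\<close> is constant.\<close>

lemma lowdeg_0_difference: "lowdeg n 0 g \<Longrightarrow> g x + g (x + v) = 0"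
proof (induction rule: lowdeg.induct)
  case (add g S)
  then have "S = {}" using finite_subset by fastforce
  with add show ?case by simp
qed simp

lemma sum_Pow_insert:
  fixes h :: "'a set \<Rightarrow> 'b::comm_monoid_add"
  assumes "finite T" "i \<notin> T"
  shows "(\<Sum>A\<in>Pow (insert i T). h A) = (\<Sum>A\<in>Pow T. h A + h (insert i A))"
proof -
  have "inj_on (insert i) (Pow T)" using assms(2) by (auto simp: inj_on_def)
  moreover have "Pow T \<inter> insert i ` Pow T = {}" using assms(2) by auto
  ultimately show ?thesis
    using assms by (simp add: Pow_insert sum.union_disjoint sum.reindex sum.distrib)
qed

text \<open>The sum is the iterated derivative of \<open>g\<close> at \<open>x\<close>, signs being
  invisible over \<open>bit\<close>. Peeling off one direction replaces \<open>g\<close> by a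
  derivative of lower degree, so more than \<open>k\<close> directions annihilate it.\<close>

lemma lowdeg_alternating_sum:
  assumes "finite T" "lowdeg n k g" "k < card T"
  shows "(\<Sum>A\<in>Pow T. g (x + (\<Sum>i\<in>A. v i))) = 0"
  using assms
proof (induction T arbitrary: k g rule: finite_induct)
  case (insert i T)
  let ?g = "\<lambda>x. g x + g (x + v i)"
  have "(\<Sum>A\<in>Pow (insert i T). g (x + (\<Sum>i\<in>A. v i))) = (\<Sum>A\<in>Pow T. ?g (x + (\<Sum>i\<in>A. v i)))"
    unfolding sum_Pow_insert[OF insert.hyps]
  proof (rule sum.cong)
    fix A assume "A \<in> Pow T"
    then have "finite A" "i \<notin> A" using insert.hyps finite_subset by auto
    then show "g (x + (\<Sum>i\<in>A. v i)) + g (x + (\<Sum>i\<in>insert i A. v i)) = ?g (x + (\<Sum>i\<in>A. v i))"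
      by (simp add: add.assoc add.commute[of "v i"])
  qed simp
  also have "\<dots> = 0"
  proof (cases "k = 0")
    case True
    then show ?thesis using lowdeg_0_difference insert.prems by (intro sum.neutral) blast
  next
    case False
    then show ?thesis using insert.prems insert.hyps
      by (intro insert.IH[of "k - 1"] lowdeg_difference) auto
  qed
  finally show ?case .
qed simp

section \<open>Passage between \<open>lowdeg\<close> and polynomial coefficients\<close>

lemma lowdeg_mleval: "lowdeg n (mldegree n p) (mleval n p)"
proof -
  have "lowdeg n (mldegree n p) (\<lambda>x. p S * (\<Prod>i\<in>S. x i))" if "S \<in> Pow {..<n}" for S
  proof (cases "p S = 0")
    case False
    then have "card S \<le> mldegree n p"
      unfolding mldegree_def using that by (intro Max_ge) auto
    then show ?thesis using that by (intro lowdeg_scale lowdeg_monomial) auto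
  qed (simp add: lowdeg.zero)
  then show ?thesis unfolding mleval_def[abs_def] by (rule lowdeg_sum)
qed

lemma lowdeg_imp_mleval:
  assumes "lowdeg n k g"
  shows "\<exists>p. (\<forall>S. p S \<noteq> 0 \<longrightarrow> card S \<le> k) \<and> (\<forall>x. mleval n p x = g x)"
  using assms
proof induction
  case zero
  show ?case by (rule exI[of _ "\<lambda>_. 0"]) (simp add: mleval_def)
next
  case (add g S)
  then obtain p where p: "\<forall>S. p S \<noteq> 0 \<longrightarrow> card S \<le> k" "\<forall>x. mleval n p x = g x" by blast
  \<comment> \<open>Adding \<open>1\<close> flips the coefficient, so a monomial that is already
    present cancels.\<close>
  have "mleval n (p(S := p S + 1)) x = (\<Prod>i\<in>S. x i) + g x" for x
  proof -
    have S: "S \<in> Pow {..<n}" "finite (Pow {..<n})" using add.hyps by auto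
    show ?thesis unfolding p(2)[rule_format, symmetric] mleval_def sum.remove[OF S(2,1)]
      by (simp add: algebra_simps)
  qed
  moreover have "\<forall>T. (p(S := p S + 1)) T \<noteq> 0 \<longrightarrow> card T \<le> k" using p(1) add.hyps(3) by simp
  ultimately show ?case by blast
qed

lemma degree_on_le:
  assumes "lowdeg n k g" "\<And>x. x \<in> U \<Longrightarrow> f x = g x"
  shows "degree_on n U f \<le> k"
proof -
  obtain p where p: "\<forall>S. p S \<noteq> 0 \<longrightarrow> card S \<le> k" "\<forall>x. mleval n p x = g x"
    using lowdeg_imp_mleval[OF assms(1)] by blast
  have "degree_on n U f \<le> mldegree n p"
    unfolding degree_on_def by (rule Least_le) (use p assms in auto)
  also have "mldegree n p \<le> k"
    unfolding mldegree_def using p by (subst Max_le_iff) auto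
  finally show ?thesis .
qed

section \<open>Elimination\<close>

text \<open>Independence of a list rather than a set: equal vectors would merge in a set, whereas
  here the length is the dimension of the span.\<close>

definition lin_indep :: "point list \<Rightarrow> bool" where
  "lin_indep xs \<longleftrightarrow> distinct xs \<and> F2.independent (set xs)"

lemma lin_indep_mset_cong: "mset xs = mset ys \<Longrightarrow> lin_indep xs = lin_indep ys"
  unfolding lin_indep_def by (metis mset_eq_imp_distinct_iff mset_eq_setD)

lemma lin_indep_Cons: "lin_indep (x # xs) \<longleftrightarrow> lin_indep xs \<and> x \<notin> F2.span (set xs)"
  using F2.span_base by (auto simp: lin_indep_def F2.independent_insert)

lemma lin_indep_add:
  assumes "lin_indep (b # c # xs)"
  shows "lin_indep ((b + c) # c # xs)"
proof -
  have "c \<in> F2.span (set (c # xs))" by (simp add: F2.span_base)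
  then have "b + c \<in> F2.span (set (c # xs)) \<longleftrightarrow> b \<in> F2.span (set (c # xs))"
    by (rule F2.span_add_eq2)
  with assms show ?thesis unfolding lin_indep_Cons[of _ "c # xs"] by simp
qed

text \<open>The pivot counts as one more vector and \<open>xs\<close> collects finished output,
  which makes the claim inductive: a step moves \<open>b\<close> or \<open>b + c\<close> into
  \<open>xs\<close> or turns \<open>b\<close> into the pivot. At the end the pivot is simply
  dropped.\<close>

lemma lin_indep_eliminate:
  "lin_indep ((case p of None \<Rightarrow> [] | Some c \<Rightarrow> [c]) @ bs @ xs) \<Longrightarrow> lin_indep (eliminate \<phi> p bs @ xs)"
proof (induction \<phi> p bs arbitrary: xs rule: eliminate.induct)
  case (1 \<phi> p)
  then show ?case by (cases p) (auto simp: lin_indep_Cons)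
next
  case (2 \<phi> p b bs)
  have perm: "lin_indep (E @ b' # xs) = lin_indep (b' # E @ xs)" for E b'
    by (rule lin_indep_mset_cong) simp
  show ?case
  proof (cases "\<phi> b = 0")
    case True
    have "lin_indep ((case p of None \<Rightarrow> [] | Some c \<Rightarrow> [c]) @ bs @ b # xs)"
      using "2.prems" by (subst lin_indep_mset_cong[where ys = "(case p of None \<Rightarrow> [] | Some c \<Rightarrow> [c]) @ (b # bs) @ xs"]) auto
    from "2.IH"(1)[OF True this] True show ?thesis by (simp add: perm)
  next
    case False
    show ?thesis
    proof (cases p)
      case None
      have "lin_indep ((case Some b of None \<Rightarrow> [] | Some c \<Rightarrow> [c]) @ bs @ xs)"
        using "2.prems" None by simp
      from "2.IH"(2)[OF False None this] False None show ?thesis by simp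
    next
      case (Some c)
      have "lin_indep (b # c # bs @ xs)"
        using "2.prems" Some by (subst lin_indep_mset_cong[where ys = "c # b # bs @ xs"]) auto
      then have "lin_indep ((b + c) # c # bs @ xs)" by (rule lin_indep_add)
      then have "lin_indep ((case p of None \<Rightarrow> [] | Some c \<Rightarrow> [c]) @ bs @ (b + c) # xs)"
        by (subst lin_indep_mset_cong[where ys = "(b + c) # c # bs @ xs"]) (use Some in auto)
      from "2.IH"(3)[OF False Some this] False Some show ?thesis by (simp add: perm)
    qed
  qed
qed

text \<open>Only the candidate that becomes the pivot is lost, and this happens at most
  once.\<close>

lemma length_eliminate:
  "length bs \<le> length (eliminate \<phi> p bs) + (case p of None \<Rightarrow> 1 | Some _ \<Rightarrow> 0)"
  by (induction \<phi> p bs rule: eliminate.induct) (auto split: option.splits)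

lemma F2_add: "x \<in> F2 n \<Longrightarrow> y \<in> F2 n \<Longrightarrow> x + y \<in> F2 n"
  by (simp add: F2_def)

lemma F2_sum: "(\<And>i. i \<in> A \<Longrightarrow> v i \<in> F2 n) \<Longrightarrow> (\<Sum>i\<in>A. v i) \<in> F2 n"
  by (induction A rule: infinite_finite_induct) (auto intro: F2_add simp: F2_def)

lemma subspace_F2: "F2.subspace (F2 n)"
  by (auto simp: F2.subspace_def F2_def scale2_def)

lemma eliminate_in_F2:
  "set bs \<subseteq> F2 n \<Longrightarrow> (\<And>c. p = Some c \<Longrightarrow> c \<in> F2 n) \<Longrightarrow> set (eliminate \<phi> p bs) \<subseteq> F2 n"
  by (induction \<phi> p bs rule: eliminate.induct) (auto simp: F2_add split: option.splits)

text \<open>Equations imposed earlier survive, as each output is a candidate or a sum of two.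
  Additivity is demanded on \<open>F2 n\<close> only, where the oracle is known to be
  polynomial.\<close>

lemma eliminate_preserves_zero:
  assumes "\<And>b c. b \<in> F2 n \<Longrightarrow> c \<in> F2 n \<Longrightarrow> \<psi> (b + c) = \<psi> b + (\<psi> c :: bit)"
    and "set bs \<subseteq> F2 n" "\<And>b. b \<in> set bs \<Longrightarrow> \<psi> b = 0"
    and "\<And>c. p = Some c \<Longrightarrow> c \<in> F2 n \<and> \<psi> c = 0"
  shows "b \<in> set (eliminate \<phi> p bs) \<Longrightarrow> \<psi> b = 0"
  using assms(2-)
  by (induction \<phi> p bs rule: eliminate.induct) (auto simp: assms(1) split: option.splits if_splits)

text \<open>A violating candidate and the pivot both have \<open>\<phi>\<close>-value
  \<open>1\<close>, and \<open>1 + 1 = 0\<close>.\<close>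

lemma eliminate_zero:
  assumes "\<And>b c. b \<in> F2 n \<Longrightarrow> c \<in> F2 n \<Longrightarrow> \<phi> (b + c) = \<phi> b + \<phi> c"
    and "set bs \<subseteq> F2 n" "\<And>c. p = Some c \<Longrightarrow> c \<in> F2 n \<and> \<phi> c = 1"
  shows "b \<in> set (eliminate \<phi> p bs) \<Longrightarrow> \<phi> b = 0"
  using assms
  by (induction \<phi> p bs rule: eliminate.induct) (auto split: option.splits if_splits)

section \<open>The greedy invariant\<close>

text \<open>\<open>f\<close> is known on \<open>F2 n\<close> only; \<open>g\<close> is a polynomial
  function of all points, to which the \<open>lowdeg\<close> calculus applies.\<close>

locale lowdeg_oracle =
  fixes n d :: nat and f g :: "point \<Rightarrow> bit"
  assumes lowdeg: "lowdeg n d g" and f: "x \<in> F2 n \<Longrightarrow> f x = g x" and d: "2 \<le> d"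
begin

text \<open>By Moebius inversion, the coefficient at the monomial \<open>T\<close> of
  \<open>f\<close> expanded in the coordinates belonging to the vectors \<open>v i\<close>.\<close>

definition coefficient :: "(nat \<Rightarrow> point) \<Rightarrow> nat set \<Rightarrow> bit" where
  "coefficient v T = (\<Sum>A\<in>Pow T. f (\<Sum>i\<in>A. v i))"

lemma coefficient_eq_0:
  assumes "finite T" "d < card T" "\<And>i. i \<in> T \<Longrightarrow> v i \<in> F2 n"
  shows "coefficient v T = 0"
proof -
  have "coefficient v T = (\<Sum>A\<in>Pow T. g (0 + (\<Sum>i\<in>A. v i)))"
    unfolding coefficient_def using assms(3)
    by (intro sum.cong) (auto intro!: f F2_sum)
  also have "\<dots> = 0" by (rule lowdeg_alternating_sum[OF assms(1) lowdeg assms(2)])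
  finally show ?thesis .
qed

lemma coefficient_insert:
  assumes "finite T" "m \<notin> T"
  shows "coefficient v (insert m T) = deriv f v T (v m)"
  unfolding coefficient_def deriv_def sum_Pow_insert[OF assms]
proof (rule sum.cong)
  fix A assume "A \<in> Pow T"
  then have "finite A" "m \<notin> A" using assms finite_subset by auto
  then show "f (\<Sum>i\<in>A. v i) + f (\<Sum>i\<in>insert m A. v i) = f (\<Sum>i\<in>A. v i) + f ((\<Sum>i\<in>A. v i) + v m)"
    by (simp add: add.commute)
qed simp

text \<open>The defect of additivity is the derivative along the \<open>d - 1\<close> directions in
  \<open>T\<close> of \<open>h\<close>, the second derivative of \<open>g\<close> along
  \<open>b\<close> and \<open>c\<close>. As \<open>h\<close> has degree at most
  \<open>d - 2\<close>, it vanishes.\<close>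

lemma deriv_add:
  assumes "finite T" "card T = d - 1" "\<And>i. i \<in> T \<Longrightarrow> v i \<in> F2 n" "b \<in> F2 n" "c \<in> F2 n"
  shows "deriv f v T (b + c) = deriv f v T b + deriv f v T c"
proof -
  define h where "h x = (g x + g (x + b)) + (g (x + c) + g (x + c + b))" for x
  have "lowdeg n (d - 1 - 1) h"
    unfolding h_def[abs_def] by (intro lowdeg_difference[of n "d - 1" "\<lambda>x. g x + g (x + b)"] lowdeg_difference lowdeg)
  then have "(\<Sum>A\<in>Pow T. h (0 + (\<Sum>i\<in>A. v i))) = 0"
    using assms d by (intro lowdeg_alternating_sum) auto
  moreover have "h (0 + (\<Sum>i\<in>A. v i)) = (f (\<Sum>i\<in>A. v i) + f ((\<Sum>i\<in>A. v i) + (b + c))) +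
      ((f (\<Sum>i\<in>A. v i) + f ((\<Sum>i\<in>A. v i) + b)) + (f (\<Sum>i\<in>A. v i) + f ((\<Sum>i\<in>A. v i) + c)))"
    if "A \<in> Pow T" for A
  proof -
    have "(\<Sum>i\<in>A. v i) \<in> F2 n" using that assms(3) by (intro F2_sum) auto
    then have eq: "f (\<Sum>i\<in>A. v i) = g (\<Sum>i\<in>A. v i)"
      "\<And>y. y \<in> F2 n \<Longrightarrow> f ((\<Sum>i\<in>A. v i) + y) = g ((\<Sum>i\<in>A. v i) + y)"
      by (auto intro: f F2_add)
    have "h (0 + (\<Sum>i\<in>A. v i)) = (f (\<Sum>i\<in>A. v i) + f ((\<Sum>i\<in>A. v i) + b)) +
        (f ((\<Sum>i\<in>A. v i) + c) + f ((\<Sum>i\<in>A. v i) + (b + c)))"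
      unfolding h_def eq(1) eq(2)[OF assms(4)] eq(2)[OF assms(5)] eq(2)[OF F2_add[OF assms(4,5)]]
      by (simp add: add.assoc add.commute[of c b])
    \<comment> \<open>On the right \<open>a\<close> occurs three times, hence once modulo 2: the
      second difference is the sum of the first differences for \<open>b + c\<close>,
      \<open>b\<close> and \<open>c\<close>.\<close>
    moreover have "a + b' + (c' + e) = (a + e) + ((a + b') + (a + c'))" for a b' c' e :: bit
      by (cases a; cases b'; cases c'; cases e) simp_all
    ultimately show ?thesis by simp
  qed
  ultimately have "deriv f v T (b + c) + (deriv f v T b + deriv f v T c) = 0"
    by (simp add: deriv_def sum.distrib)
  then show ?thesis
    by (cases "deriv f v T (b + c)"; cases "deriv f v T b"; cases "deriv f v T c") simp_all
qed

text \<open>The last conjunct is the potential that guarantees candidates; the \<open>n\<close> unit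
  points and the single set \<open>{}\<close> give equality at the start.\<close>

definition greedy :: "nat \<Rightarrow> (nat \<Rightarrow> point) \<Rightarrow> nat set list \<Rightarrow> point list \<Rightarrow> bool" where
  "greedy k v Ls B \<longleftrightarrow> distinct Ls \<and> set Ls = {T. T \<subseteq> {1..k} \<and> card T \<le> d - 1} \<and> k + 1 \<le> length Ls \<and>
    lin_indep (B @ map v [1..<Suc k]) \<and> v ` {1..k} \<subseteq> F2 n \<and> set B \<subseteq> F2 n \<and>
    (\<forall>b\<in>set B. \<forall>T\<in>set Ls. card T = d - 1 \<longrightarrow> deriv f v T b = 0) \<and>
    (\<forall>T. T \<subseteq> {1..k} \<longrightarrow> card T = d \<longrightarrow> coefficient v T = 0) \<and>
    n + 2 \<le> length B + 2 * length Ls"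

text \<open>\<open>M\<close> holds the sets whose equations \<open>B\<close> already satisfies; they
  survive, and each set of \<open>N\<close> costs at most one candidate. \<open>xs\<close> stands
  for the directions already chosen.\<close>

lemma eliminate_top_invariant:
  assumes "lin_indep (B @ xs)" "set B \<subseteq> F2 n"
    and N: "\<And>T. T \<in> set N \<Longrightarrow> finite T \<and> v ` T \<subseteq> F2 n"
    and M: "\<And>T. T \<in> M \<Longrightarrow> finite T \<and> v ` T \<subseteq> F2 n \<and> card T = d - 1 \<and> (\<forall>b\<in>set B. deriv f v T b = 0)"
  shows "lin_indep (eliminate_top f d v B N @ xs) \<and> set (eliminate_top f d v B N) \<subseteq> F2 n \<and>
    (\<forall>b\<in>set (eliminate_top f d v B N). \<forall>T\<in>set N \<union> M. card T = d - 1 \<longrightarrow> deriv f v T b = 0) \<and>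
    length B \<le> length (eliminate_top f d v B N) + length N"
  using N
proof (induction N rule: rev_induct)
  case Nil
  then show ?case using assms by (auto simp: eliminate_top_def)
next
  case (snoc T N)
  let ?B = "eliminate_top f d v B N"
  have IH: "lin_indep (?B @ xs)" "set ?B \<subseteq> F2 n"
    "\<And>b T. b \<in> set ?B \<Longrightarrow> T \<in> set N \<union> M \<Longrightarrow> card T = d - 1 \<Longrightarrow> deriv f v T b = 0"
    "length B \<le> length ?B + length N"
    using snoc by auto
  show ?case
  proof (cases "card T = d - 1")
    case False
    then have "eliminate_top f d v B (N @ [T]) = ?B" by (simp add: eliminate_top_def)
    then show ?thesis using IH False by auto
  next
    case True
    let ?\<phi> = "deriv f v T"
    have eq: "eliminate_top f d v B (N @ [T]) = eliminate ?\<phi> None ?B"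
      using True by (simp add: eliminate_top_def)
    have add: "deriv f v S (b + c) = deriv f v S b + deriv f v S c"
      if "S \<in> set (N @ [T]) \<union> M" "card S = d - 1" "b \<in> F2 n" "c \<in> F2 n" for S b c
      using that snoc.prems[of S] M[of S] by (intro deriv_add) auto
    have "deriv f v S b = 0"
      if b: "b \<in> set (eliminate ?\<phi> None ?B)" and S: "S \<in> set (N @ [T]) \<union> M" "card S = d - 1" for b S
    proof (cases "S = T")
      case True
      show ?thesis unfolding True
        by (rule eliminate_zero[OF add[OF S, unfolded True] IH(2) _ b]) simp_all
    next
      case False
      then have "S \<in> set N \<union> M" using S by auto
      show ?thesis
        by (rule eliminate_preserves_zero[where \<psi> = "deriv f v S", OF add[OF S] IH(2) _ _ b])
          (use IH(3)[OF _ \<open>S \<in> set N \<union> M\<close> S(2)] in simp_all)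
    qed
    moreover have "lin_indep (eliminate ?\<phi> None ?B @ xs)"
      by (rule lin_indep_eliminate) (use IH(1) in simp)
    moreover have "set (eliminate ?\<phi> None ?B) \<subseteq> F2 n"
      by (rule eliminate_in_F2) (use IH(2) in auto)
    moreover have "length B \<le> length (eliminate ?\<phi> None ?B) + length (N @ [T])"
      using length_eliminate[of ?B ?\<phi> None] IH(4) by simp
    ultimately show ?thesis unfolding eq by blast
  qed
qed

lemma set_new_sets:
  assumes "set Ls = {T. T \<subseteq> {1..k} \<and> card T \<le> d - 1}"
  shows "set (Ls @ new_sets d (Suc k) Ls) = {T. T \<subseteq> {1..Suc k} \<and> card T \<le> d - 1}" (is "?L = ?R")
proof
  have fin: "finite T" if "T \<subseteq> {1..m}" for T and m :: nat using that finite_subset by blast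
  show "?L \<subseteq> ?R"
  proof
    fix T assume "T \<in> ?L"
    then consider "T \<in> set Ls" | S where "S \<in> set Ls" "card S < d - 1" "T = insert (Suc k) S"
      by (auto simp: new_sets_def)
    then show "T \<in> ?R"
    proof cases
      case 1
      then show ?thesis unfolding assms by auto
    next
      case 2
      then have "S \<subseteq> {1..k}" unfolding assms by simp
      then show ?thesis using 2 by (auto simp: card_insert_if fin)
    qed
  qed
  show "?R \<subseteq> ?L"
  proof
    fix T assume T: "T \<in> ?R"
    show "T \<in> ?L"
    proof (cases "Suc k \<in> T")
      case False
      then have "T \<in> set Ls" unfolding assms using T by (auto simp: atLeastAtMostSuc_conv)
      then show ?thesis by simp
    next
      case True
      let ?S = "T - {Suc k}"
      have "card T = Suc (card ?S)" using T True card.remove[OF fin[of T "Suc k"]] by blast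
      then have "card ?S < d - 1" using T by auto
      moreover from this have "?S \<in> set Ls" unfolding assms using T by (auto simp: atLeastAtMostSuc_conv)
      moreover have "insert (Suc k) S \<in> set (new_sets d (Suc k) Ls)" if "card S < d - 1" "S \<in> set Ls" for S
        using that by (simp add: new_sets_def)
      ultimately have "insert (Suc k) ?S \<in> set (new_sets d (Suc k) Ls)" by blast
      then show ?thesis using True by (simp add: insert_absorb)
    qed
  qed
qed

text \<open>A \<open>d\<close>-set containing the new index has as coefficient the derivative of an
  old \<open>(d - 1)\<close>-set at \<open>b\<close>, which is \<open>0\<close> because
  \<open>b\<close> was a candidate. The potential loses at most \<open>1 + length N\<close> and
  gains \<open>2 * length N\<close>.\<close>

lemma greedy_step:
  assumes gr: "greedy k v Ls (B @ [b])"
    and N: "N = new_sets d (Suc k) Ls" and v': "v' = v(Suc k := b)"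
  shows "greedy (Suc k) v' (Ls @ N) (eliminate_top f d v' B N)"
proof -
  have Ls: "distinct Ls" "set Ls = {T. T \<subseteq> {1..k} \<and> card T \<le> d - 1}" "k + 1 \<le> length Ls"
    and lin_indep: "lin_indep ((B @ [b]) @ map v [1..<Suc k])" and F2: "v ` {1..k} \<subseteq> F2 n" "set (B @ [b]) \<subseteq> F2 n"
    and der: "\<forall>c\<in>set (B @ [b]). \<forall>T\<in>set Ls. card T = d - 1 \<longrightarrow> deriv f v T c = 0"
    and coef: "\<forall>T. T \<subseteq> {1..k} \<longrightarrow> card T = d \<longrightarrow> coefficient v T = 0"
    and len: "n + 2 \<le> length (B @ [b]) + 2 * length Ls"
    using gr[unfolded greedy_def] by - (elim conjE, assumption)+
  have sub: "T \<subseteq> {1..k}" if "T \<in> set Ls" for T using that unfolding Ls(2) by simp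
  have notin: "Suc k \<notin> T" if "T \<subseteq> {1..k}" for T using that by auto
  have set: "set (Ls @ N) = {T. T \<subseteq> {1..Suc k} \<and> card T \<le> d - 1}"
    unfolding N by (rule set_new_sets[OF Ls(2)])
  have "inj_on (insert (Suc k)) (set Ls)"
    using notin sub by (intro inj_onI) (metis insert_ident)
  then have dist: "distinct (Ls @ N)"
    using Ls(1) notin sub
    by (auto simp: N new_sets_def distinct_map intro!: inj_on_subset[of _ "set Ls"])
  \<comment> \<open>As \<open>d \<ge> 2\<close>, the empty set is extendable, so a round always adds
    \<open>{Suc k}\<close>.\<close>
  have "{} \<in> set Ls" unfolding Ls(2) by simp
  then have "insert (Suc k) {} \<in> set N" using d by (auto simp: N new_sets_def)
  then have "N \<noteq> []" by auto
  then have lenN: "1 \<le> length N" by (cases N) auto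
  have v'_cong: "v' i = v i" if "i \<noteq> Suc k" for i using that v' by simp
  have sums: "(\<Sum>i\<in>A. v' i) = (\<Sum>i\<in>A. v i)" if "A \<subseteq> {1..k}" for A
    using notin[OF that] by (intro sum.cong v'_cong) auto
  have der': "deriv f v' T c = deriv f v T c" if "T \<subseteq> {1..k}" for T c
    unfolding deriv_def using that by (intro sum.cong refl) (simp add: sums subset_trans)
  have coef': "coefficient v' T = coefficient v T" if "T \<subseteq> {1..k}" for T
    unfolding coefficient_def using that by (intro sum.cong refl) (simp add: sums subset_trans)
  have F2': "v' ` {1..Suc k} \<subseteq> F2 n"
    using F2 by (auto simp: v' atLeastAtMostSuc_conv)
  have lin_indep': "lin_indep (B @ map v' [1..<Suc (Suc k)])"
  proof -
    have eq: "map v' [1..<Suc (Suc k)] = map v [1..<Suc k] @ [b]"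
      by (simp add: v')
    have "lin_indep (B @ map v [1..<Suc k] @ [b]) = lin_indep ((B @ [b]) @ map v [1..<Suc k])"
      by (rule lin_indep_mset_cong) (simp del: upt_Suc)
    with lin_indep show ?thesis unfolding eq by blast
  qed
  let ?M = "{T \<in> set Ls. card T = d - 1}"
  have inv: "lin_indep (eliminate_top f d v' B N @ map v' [1..<Suc (Suc k)]) \<and>
    set (eliminate_top f d v' B N) \<subseteq> F2 n \<and>
    (\<forall>b\<in>set (eliminate_top f d v' B N). \<forall>T\<in>set N \<union> ?M. card T = d - 1 \<longrightarrow> deriv f v' T b = 0) \<and>
    length B \<le> length (eliminate_top f d v' B N) + length N"
  proof (rule eliminate_top_invariant[OF lin_indep'])
    show "set B \<subseteq> F2 n" using F2 by simp
    have all: "finite T \<and> v' ` T \<subseteq> F2 n" if "T \<in> set (Ls @ N)" for T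
    proof -
      have "T \<subseteq> {1..Suc k}" using that unfolding set by simp
      then show ?thesis using F2' finite_subset by blast
    qed
    show "finite T \<and> v' ` T \<subseteq> F2 n" if "T \<in> set N" for T using all that by simp
    show "finite T \<and> v' ` T \<subseteq> F2 n \<and> card T = d - 1 \<and> (\<forall>b\<in>set B. deriv f v' T b = 0)"
      if "T \<in> ?M" for T
      using that all[of T] der der'[OF sub[of T]] by simp
  qed
  have "coefficient v' T = 0" if T: "T \<subseteq> {1..Suc k}" "card T = d" for T
  proof (cases "Suc k \<in> T")
    case False
    then have "T \<subseteq> {1..k}" using T by (auto simp: atLeastAtMostSuc_conv)
    then show ?thesis using coef coef' T by simp
  next
    case True
    let ?S = "T - {Suc k}"
    have fin: "finite T" using T(1) finite_subset by blast
    have S: "?S \<subseteq> {1..k}" "card ?S = d - 1" using T True fin by (auto simp: atLeastAtMostSuc_conv)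
    then have "?S \<in> set Ls" unfolding Ls(2) by simp
    have "coefficient v' T = deriv f v' ?S (v' (Suc k))"
      using coefficient_insert[of ?S "Suc k" v'] fin True by (simp add: insert_absorb)
    also have "\<dots> = deriv f v ?S b" using der'[OF S(1)] by (simp add: v')
    also have "\<dots> = 0" using der S(2) \<open>?S \<in> set Ls\<close> by simp
    finally show ?thesis .
  qed
  moreover have "deriv f v' T c = 0"
    if "c \<in> set (eliminate_top f d v' B N)" "T \<in> set (Ls @ N)" "card T = d - 1" for c T
    using inv that by auto
  moreover have "n + 2 \<le> length (eliminate_top f d v' B N) + 2 * length (Ls @ N)"
    using inv len lenN by simp
  ultimately show ?thesis
    unfolding greedy_def using dist set inv F2' Ls(3) lenN by auto
qed

lemma greedy_init: "greedy 0 v [{}] (map unit_point [0..<n])"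
proof -
  have F2: "unit_point i \<in> F2 m" if "i < m" for i m
    using that by (auto simp: unit_point_def F2_def)
  \<comment> \<open>Reversal puts the new unit point at the head; it lies outside
    \<open>F2 m\<close>, which contains the span of the others.\<close>
  have "lin_indep (map unit_point (rev [0..<m]))" for m
  proof (induction m)
    case 0
    then show ?case by (simp add: lin_indep_def F2.independent_empty)
  next
    case (Suc m)
    have "F2.span (set (map unit_point (rev [0..<m]))) \<subseteq> F2 m"
      by (rule F2.span_minimal) (auto simp: F2 subspace_F2)
    moreover have "unit_point m \<notin> F2 m" by (auto simp: unit_point_def F2_def)
    ultimately show ?case using Suc by (auto simp: lin_indep_Cons)
  qed
  then have "lin_indep (map unit_point [0..<n])"
    by (subst lin_indep_mset_cong[where ys = "map unit_point (rev [0..<n])"]) (auto simp flip: rev_map)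
  then show ?thesis
    using F2 d by (auto simp: greedy_def finite_subset[of _ "{}"])
qed

end

section \<open>The output\<close>

text \<open>Moebius inversion on subsets, self-inverse over \<open>bit\<close>: the sets that omit
  \<open>i\<close> are counted twice and cancel.\<close>

lemma sum_subset_sums:
  fixes F :: "'a set \<Rightarrow> bit"
  assumes "finite A"
  shows "(\<Sum>T\<in>Pow A. \<Sum>C\<in>Pow T. F C) = F A"
  using assms
proof (induction A arbitrary: F rule: finite_induct)
  case (insert i A)
  have "(\<Sum>T\<in>Pow (insert i A). \<Sum>C\<in>Pow T. F C) = (\<Sum>T\<in>Pow A. \<Sum>C\<in>Pow T. F (insert i C))"
    unfolding sum_Pow_insert[OF insert.hyps]
  proof (rule sum.cong)
    fix T assume "T \<in> Pow A"
    then have T: "finite T" "i \<notin> T" using insert.hyps finite_subset by auto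
    show "(\<Sum>C\<in>Pow T. F C) + (\<Sum>C\<in>Pow (insert i T). F C) = (\<Sum>C\<in>Pow T. F (insert i C))"
      unfolding sum_Pow_insert[OF T] sum.distrib by (simp add: add.assoc[symmetric])
  qed simp
  also have "\<dots> = F (insert i A)" by (rule insert.IH)
  finally show ?case .
qed simp

lemma span_eq_subset_sums:
  assumes "inj_on v I" "finite I" "x \<in> F2.span (v ` I)"
  obtains A where "A \<subseteq> I" "x = (\<Sum>i\<in>A. v i)"
proof -
  obtain u where "x = (\<Sum>w\<in>v ` I. scale2 (u w) w)"
    using assms F2.span_finite[of "v ` I"] by auto
  also have "\<dots> = (\<Sum>i\<in>I. scale2 (u (v i)) (v i))"
    by (rule sum.reindex_cong[OF assms(1)]) simp_all
  also have "\<dots> = (\<Sum>i\<in>I. if u (v i) = 1 then v i else 0)"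
  proof (rule sum.cong)
    show "scale2 (u (v i)) (v i) = (if u (v i) = 1 then v i else 0)" for i
      by (cases "u (v i)") simp_all
  qed simp
  also have "\<dots> = (\<Sum>i\<in>{i \<in> I. u (v i) = 1}. v i)"
    using assms(2) by (simp add: sum.inter_filter)
  finally show thesis by (intro that[of "{i \<in> I. u (v i) = 1}"]) auto
qed

text \<open>Dual functionals exist by linear extension from the independent family; their values on
  the unit points are the coefficients \<open>a\<close>.\<close>

lemma dual_linear_forms:
  assumes "inj_on v I" "F2.independent (v ` I)" "v ` I \<subseteq> F2 n"
  obtains a where "\<And>i i'. i \<in> I \<Longrightarrow> i' \<in> I \<Longrightarrow> (\<Sum>j<n. a i j * v i' j) = (of_bool (i = i') :: bit)"
proof -
  interpret vector_space "(*) :: bit \<Rightarrow> bit \<Rightarrow> bit"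
    by unfold_locales (simp_all add: algebra_simps)
  interpret vector_space_pair scale2 "(*) :: bit \<Rightarrow> bit \<Rightarrow> bit" ..
  have "\<exists>b. \<forall>i'\<in>I. (\<Sum>j<n. b j * v i' j) = of_bool (i = i')" if "i \<in> I" for i
  proof -
    obtain h where h: "Vector_Spaces.linear scale2 (*) h" "\<And>w. w \<in> v ` I \<Longrightarrow> h w = (of_bool (w = v i) :: bit)"
      using linear_independent_extend[OF assms(2), of "\<lambda>w. of_bool (w = v i)"] by blast
    interpret h: Vector_Spaces.linear scale2 "(*)" h by (rule h(1))
    have "(\<Sum>j<n. h (unit_point j) * w j) = h w" if "w \<in> F2 n" for w
    proof -
      have "w = (\<Sum>j<n. scale2 (w j) (unit_point j))"
      proof
        fix i
        have "(\<Sum>j<n. scale2 (w j) (unit_point j)) i = (\<Sum>j<n. scale2 (w j) (unit_point j) i)"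
          by (induction n) simp_all
        also have "\<dots> = (\<Sum>j<n. if j = i then w j else 0)"
          by (intro sum.cong) (auto simp: scale2_def unit_point_def)
        also have "\<dots> = w i" using that by (auto simp: F2_def)
        finally show "w i = (\<Sum>j<n. scale2 (w j) (unit_point j)) i" by simp
      qed
      then have "h w = (\<Sum>j<n. h (scale2 (w j) (unit_point j)))" by (metis h.sum)
      also have "\<dots> = (\<Sum>j<n. h (unit_point j) * w j)" by (simp add: h.scale mult.commute)
      finally show ?thesis by simp
    qed
    with h(2) assms(1,3) that show ?thesis
      by (intro exI[of _ "\<lambda>j. h (unit_point j)"]) (auto simp: inj_on_eq_iff)
  qed
  then obtain a where "\<forall>i\<in>I. \<forall>i'\<in>I. (\<Sum>j<n. a i j * v i' j) = (of_bool (i = i') :: bit)"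
    by metis
  then show thesis using that by blast
qed

context lowdeg_oracle
begin

text \<open>The witness \<open>h\<close> is the expansion of \<open>f\<close> with dual forms as
  coordinates, cut off at size \<open>d - 1\<close>; coefficients of size \<open>d\<close> vanish by
  assumption, larger ones by degree. At the sum over \<open>A\<close>, the product for
  \<open>T\<close> is the indicator of \<open>T \<subseteq> A\<close>, so inversion returns
  \<open>f\<close>.\<close>

lemma degree_on_span_le:
  assumes "lin_indep (map v [1..<Suc k])" "v ` {1..k} \<subseteq> F2 n"
    and coef: "\<And>T. T \<subseteq> {1..k} \<Longrightarrow> card T = d \<Longrightarrow> coefficient v T = 0"
  shows "degree_on n (F2.span (v ` {1..k})) f \<le> d - 1"
proof -
  let ?I = "{1..k}"
  have "set [1..<Suc k] = ?I" by auto
  then have inj: "inj_on v ?I" and ind: "F2.independent (v ` ?I)"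
    using assms(1) unfolding lin_indep_def distinct_map set_map by simp_all
  obtain a where a: "\<And>i i'. i \<in> ?I \<Longrightarrow> i' \<in> ?I \<Longrightarrow> (\<Sum>j<n. a i j * v i' j) = (of_bool (i = i') :: bit)"
    using dual_linear_forms[OF inj ind assms(2)] by blast
  have coef0: "coefficient v T = 0" if "T \<subseteq> ?I" "\<not> card T \<le> d - 1" for T
  proof (cases "card T = d")
    case False
    then have "d < card T" using that(2) by simp
    moreover have "finite T" "\<And>i. i \<in> T \<Longrightarrow> v i \<in> F2 n"
      using that(1) assms(2) finite_subset by blast+
    ultimately show ?thesis by (intro coefficient_eq_0)
  qed (use coef that in blast)
  define h where "h x = (\<Sum>T\<in>{T \<in> Pow ?I. card T \<le> d - 1}. coefficient v T * (\<Prod>i\<in>T. \<Sum>j<n. a i j * x j))" for x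
  have "lowdeg n (d - 1) h"
    unfolding h_def[abs_def]
  proof (intro lowdeg_sum lowdeg_scale)
    fix T assume "T \<in> {T \<in> Pow ?I. card T \<le> d - 1}"
    then have "finite T" "card T \<le> d - 1" using finite_subset by auto
    then show "lowdeg n (d - 1) (\<lambda>x. \<Prod>i\<in>T. \<Sum>j<n. a i j * x j)"
      by (intro lowdeg_mono[OF lowdeg_prod_linear_forms])
  qed
  then show ?thesis
  proof (rule degree_on_le)
    fix x assume "x \<in> F2.span (v ` ?I)"
    then obtain A where A: "A \<subseteq> ?I" "x = (\<Sum>i\<in>A. v i)"
      using span_eq_subset_sums[OF inj] by blast
    then have fin: "finite A" using finite_subset by blast
    have form: "(\<Sum>j<n. a i j * x j) = of_bool (i \<in> A)" if "i \<in> ?I" for i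
    proof -
      have "x j = (\<Sum>i'\<in>A. v i' j)" for j
        unfolding A(2) using fin by (induction A rule: finite_induct) simp_all
      then have "(\<Sum>j<n. a i j * x j) = (\<Sum>i'\<in>A. \<Sum>j<n. a i j * v i' j)"
        by (simp add: sum_distrib_left sum.swap[of _ _ A])
      also have "\<dots> = (\<Sum>i'\<in>A. if i' = i then 1 else 0)"
        using A(1) that by (intro sum.cong) (auto simp: a)
      finally show ?thesis using fin by (simp add: of_bool_def)
    qed
    have prod: "(\<Prod>i\<in>T. \<Sum>j<n. a i j * x j) = of_bool (T \<subseteq> A)" if "T \<subseteq> ?I" for T
    proof -
      have "finite T" using that finite_subset by blast
      then show ?thesis using that
        by (induction T rule: finite_induct) (auto simp: form)
    qed
    have "h x = (\<Sum>T\<in>{T \<in> Pow ?I. card T \<le> d - 1}. if T \<subseteq> A then coefficient v T else 0)"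
      unfolding h_def by (intro sum.cong refl) (auto simp: prod)
    also have "\<dots> = (\<Sum>T\<in>Pow A. coefficient v T)"
      using A(1) fin by (intro sum.mono_neutral_cong) (auto intro!: coef0)
    also have "\<dots> = f x"
      unfolding coefficient_def A(2) by (rule sum_subset_sums[OF fin])
    finally show "f x = h x" by simp
  qed
qed

end

section \<open>The dimension\<close>

lemma sum_Pow_power_card:
  fixes x :: "'b::comm_semiring_1"
  assumes "finite I"
  shows "(\<Sum>T\<in>Pow I. x ^ card T) = (1 + x) ^ card I"
  using assms
proof (induction I rule: finite_induct)
  case (insert i I)
  have "(\<Sum>T\<in>Pow (insert i I). x ^ card T) = (\<Sum>T\<in>Pow I. (1 + x) * x ^ card T)"
    unfolding sum_Pow_insert[OF insert.hyps]
  proof (rule sum.cong)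
    fix T assume "T \<in> Pow I"
    then have "finite T" "i \<notin> T" using insert.hyps finite_subset by auto
    then show "x ^ card T + x ^ card (insert i T) = (1 + x) * x ^ card T"
      by (simp add: algebra_simps)
  qed simp
  also have "\<dots> = (1 + x) * (\<Sum>T\<in>Pow I. x ^ card T)" by (simp add: sum_distrib_left)
  finally show ?case using insert by simp
qed simp

text \<open>Weight each set by \<open>x ^ card T\<close>. For \<open>x \<le> 1\<close> the small
  sets weigh at least \<open>x ^ D\<close> each, while the total is
  \<open>(1 + x) ^ k \<le> exp x ^ k\<close>; the choice \<open>x = D / k\<close> balances the
  two.\<close>

lemma card_small_subsets_le:
  fixes k D :: nat
  assumes "0 < D" "D \<le> k"
  shows "real (card {T. T \<subseteq> {1..k} \<and> card T \<le> D}) \<le> (exp 1 * real k / real D) ^ D"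
proof -
  define x where "x = real D / real k"
  have x: "0 < x" "x \<le> 1" using assms by (simp_all add: x_def)
  let ?S = "{T. T \<subseteq> {1..k} \<and> card T \<le> D}"
  have S: "?S \<subseteq> Pow {1..k}" by auto
  have "real (card ?S) * x ^ D = (\<Sum>T\<in>?S. x ^ D)" by simp
  also have "\<dots> \<le> (\<Sum>T\<in>?S. x ^ card T)"
    using x by (intro sum_mono power_decreasing) auto
  also have "\<dots> \<le> (\<Sum>T\<in>Pow {1..k}. x ^ card T)"
    using x S by (intro sum_mono2) auto
  also have "\<dots> = (1 + x) ^ k" by (simp add: sum_Pow_power_card)
  also have "\<dots> \<le> exp x ^ k" using x by (intro power_mono) (auto intro: exp_ge_add_one_self)
  also have "\<dots> = exp 1 ^ D"
    using assms by (simp add: x_def exp_of_nat_mult[symmetric])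
  finally have "real (card ?S) \<le> exp 1 ^ D / x ^ D" using x by (simp add: field_simps)
  also have "\<dots> = (exp 1 * real k / real D) ^ D"
    by (simp add: x_def power_divide power_mult_distrib)
  finally show ?thesis .
qed

text \<open>The estimate of the count is solved for \<open>k\<close> by a \<open>D\<close>-th root.
  The constant \<open>1 / 12\<close> comes from \<open>2 * exp 1 \<le> 6\<close> and
  \<open>d \<le> 2 * D\<close>.\<close>

lemma dimension_lower_bound:
  fixes n d k :: nat
  assumes d: "2 \<le> d" and n: "2 ^ (3 * d) \<le> n"
    and card: "n < 2 * card {T. T \<subseteq> {1..k} \<and> card T \<le> d - 1}"
  shows "1 / 12 * real d * real n powr (1 / (real d - 1)) \<le> real k"
proof -
  define D where "D = d - 1"
  have D: "0 < D" "real d - 1 = real D" "d = D + 1" using d by (simp_all add: D_def)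
  \<comment> \<open>Otherwise the count is at most \<open>2 ^ k \<le> 2 ^ D\<close>, giving
    \<open>n < 2 ^ d\<close> against the bound on \<open>d\<close>.\<close>
  have "D \<le> k"
  proof (rule ccontr)
    assume "\<not> D \<le> k"
    have "card {T. T \<subseteq> {1..k} \<and> card T \<le> d - 1} \<le> card (Pow {1..k})" by (intro card_mono) auto
    also have "\<dots> = 2 ^ k" by (simp add: card_Pow)
    also have "\<dots> \<le> 2 ^ D" using \<open>\<not> D \<le> k\<close> by (intro power_increasing) auto
    finally have "n < 2 ^ d" using card D by simp
    moreover have "(2::nat) ^ d \<le> 2 ^ (3 * d)" by (intro power_increasing) auto
    ultimately show False using n by linarith
  qed
  let ?y = "exp 1 * real k / real D"
  have y: "0 \<le> ?y" by simp
  have "real n \<le> 2 * real (card {T. T \<subseteq> {1..k} \<and> card T \<le> D})"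
    using card unfolding D_def by linarith
  also have "\<dots> \<le> 2 * ?y ^ D" using card_small_subsets_le[OF D(1) \<open>D \<le> k\<close>] by simp
  \<comment> \<open>Enlarging \<open>2\<close> to \<open>2 ^ D\<close> makes the right side a
    perfect \<open>D\<close>-th power, at the price of a constant factor in
    \<open>k\<close>.\<close>
  also have "\<dots> \<le> 2 ^ D * ?y ^ D"
    using D(1) y self_le_power[of "2::real" D] by (intro mult_right_mono) auto
  finally have "real n \<le> (2 * ?y) ^ D" by (simp only: power_mult_distrib)
  then have "real n powr (1 / real D) \<le> ((2 * ?y) ^ D) powr (1 / real D)"
    by (intro powr_mono2) auto
  also have "\<dots> = 2 * ?y"
  proof (cases "k = 0")
    case False
    then have "0 < 2 * ?y" using D(1) by simp
    then show ?thesis using D(1) by (simp add: powr_powr flip: powr_realpow)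
  qed (use D(1) in simp)
  finally have "real D * real n powr (1 / real D) \<le> 2 * exp 1 * real k"
    using D(1) by (simp add: field_simps)
  also have "\<dots> \<le> 2 * 3 * real k" using exp_le by (intro mult_mono) auto
  finally have "real D * real n powr (1 / real D) \<le> 6 * real k" by simp
  moreover have "real d * real n powr (1 / real D) \<le> 2 * real D * real n powr (1 / real D)"
    using D by (intro mult_right_mono) auto
  ultimately show ?thesis unfolding D(2) by simp
qed

section \<open>The main loop\<close>

context lowdeg_oracle
begin

text \<open>Every round adds a set, so \<open>n + 1 - l\<close> decreases; this bounds the number of
  rounds.\<close>

lemma halts_Main:
  assumes "0 < n"
  shows "halts n f Main (input_state n d) (4000 * (n + 1) ^ 5)
    (\<lambda>s. \<exists>k v Ls B. stores n d k v Ls B s \<and> greedy k v Ls B \<and> n < 2 * length Ls)"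
proof -
  let ?I = "\<lambda>s. \<exists>k v Ls B. stores n d k v Ls B s \<and> greedy k v Ls B"
  let ?e = "Sub (Add (Var ''n'') (Const 1)) (Add (Var ''l'') (Var ''l''))"
  have val: "s ''l'' 0 = length Ls" "val ?e s = n + 1 - 2 * length Ls"
    if "stores n d k v Ls B s" for k v Ls B s
    using that by (simp_all add: stores_def multiples_def stores_sets_def)
  have step: "halts n f Step s (1000 * (n + 1) ^ 4) (\<lambda>s'. ?I s' \<and> n + 1 - s' ''l'' 0 < n + 1 - s ''l'' 0)"
    if I: "?I s" and guard: "val ?e s \<noteq> 0" for s
  proof -
    obtain k v Ls B where st: "stores n d k v Ls B s" and gr: "greedy k v Ls B" using I by blast
    have len: "2 * length Ls \<le> n" using guard val[OF st] by simp
    have Ls: "set Ls = {T. T \<subseteq> {1..k} \<and> card T \<le> d - 1}" "k + 1 \<le> length Ls"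
        "n + 2 \<le> length B + 2 * length Ls"
      using gr[unfolded greedy_def] by - (elim conjE, assumption)+
    \<comment> \<open>The potential leaves at least two candidates as long as the guard
      holds.\<close>
    have "B \<noteq> []" using len Ls(3) by auto
    then obtain B' b where B: "B = B' @ [b]" by (cases B rule: rev_cases) auto
    define N where "N = new_sets d (Suc k) Ls"
    define v' where "v' = v(Suc k := b)"
    have gr': "greedy (Suc k) v' (Ls @ N) (eliminate_top f d v' B' N)"
      by (rule greedy_step[OF gr[unfolded B] N_def v'_def])
    then have N: "distinct (Ls @ N)" "set (Ls @ N) = {T. T \<subseteq> {1..Suc k} \<and> card T \<le> d - 1}"
      unfolding greedy_def by - (elim conjE, assumption)+
    have "Suc k \<notin> \<Union> (set Ls)" unfolding Ls(1) by auto
    moreover have "{Suc k} \<in> set (Ls @ N)" unfolding N(2) using d by simp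
    ultimately have "N \<noteq> []" by auto
    show ?thesis
    proof (rule halts_weaken[OF halts_Step[OF st[unfolded B] Ls(1,2) len N_def N v'_def]])
      fix s' assume st': "stores n d (Suc k) v' (Ls @ N) (eliminate_top f d v' B' N) s'"
      then have "s' ''l'' 0 = length Ls + length N" using val(1)[OF st'] by simp
      moreover have "0 < length N" using \<open>N \<noteq> []\<close> by simp
      ultimately have "n + 1 - s' ''l'' 0 < n + 1 - s ''l'' 0"
        using len unfolding val(1)[OF st] by linarith
      with st' gr' show "?I s' \<and> n + 1 - s' ''l'' 0 < n + 1 - s ''l'' 0" by blast
    qed simp
  qed
  have "halts n f Main (input_state n d)
    (100 * (n + 1) + (n + 2) * (1 + cost ?e + 1000 * (n + 1) ^ 4)) (\<lambda>s. ?I s \<and> val ?e s = 0)"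
    unfolding Main_def
  proof (rule halts_Seq[OF halts_Init[OF assms]])
    fix s assume st: "stores n d 0 (\<lambda>_. 0) [{}] (map unit_point [0..<n]) s"
    have "halts n f (While ?e Step) s ((n + 1 - s ''l'' 0 + 1) * (1 + cost ?e + 1000 * (n + 1) ^ 4))
        (\<lambda>s. ?I s \<and> val ?e s = 0)"
    proof (rule halts_While[where \<mu> = "\<lambda>s. n + 1 - s ''l'' 0"])
      show "?I s" using st greedy_init by blast
    qed (rule step)
    then show "halts n f (While ?e Step) s ((n + 2) * (1 + cost ?e + 1000 * (n + 1) ^ 4))
        (\<lambda>s. ?I s \<and> val ?e s = 0)"
      by (rule halts_weaken) (intro mult_le_mono; simp)
  qed
  then show ?thesis
  proof (rule halts_weaken)
    fix s assume "?I s \<and> val ?e s = 0"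
    then obtain k v Ls B where st: "stores n d k v Ls B s" and gr: "greedy k v Ls B" and "val ?e s = 0"
      by blast
    then have "n < 2 * length Ls" using val(2)[OF st] by simp
    with st gr show "\<exists>k v Ls B. stores n d k v Ls B s \<and> greedy k v Ls B \<and> n < 2 * length Ls" by blast
  next
    have "(n + 1) ^ 1 \<le> (n + 1) ^ 5" "(n + 1) ^ 0 \<le> (n + 1) ^ 4"
      by (rule power_increasing; simp)+
    then have "n + 1 \<le> (n + 1) ^ 5" "1 \<le> (n + 1) ^ 4" by simp_all
    have "(n + 2) * (1 + cost ?e + 1000 * (n + 1) ^ 4) \<le> (2 * (n + 1)) * (1100 * (n + 1) ^ 4)"
    proof (rule mult_le_mono)
      show "1 + cost ?e + 1000 * (n + 1) ^ 4 \<le> 1100 * (n + 1) ^ 4"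
        unfolding cost.simps using \<open>1 \<le> (n + 1) ^ 4\<close> by linarith
    qed simp
    also have "\<dots> = 2200 * (n + 1) ^ 5" using power_add[of "n + 1" 1 4] by simp
    finally have "100 * (n + 1) + (n + 2) * (1 + cost ?e + 1000 * (n + 1) ^ 4)
        \<le> 100 * (n + 1) ^ 5 + 2200 * (n + 1) ^ 5"
      using \<open>n + 1 \<le> (n + 1) ^ 5\<close> by (intro add_mono mult_le_mono2)
    also have "\<dots> \<le> 4000 * (n + 1) ^ 5" by simp
    finally show "100 * (n + 1) + (n + 2) * (1 + cost ?e + 1000 * (n + 1) ^ 4) \<le> 4000 * (n + 1) ^ 5" .
  qed
qed

lemma output_correct:
  assumes st: "stores n d k v Ls B s" and gr: "greedy k v Ls B"
    and n: "2 ^ (3 * d) \<le> n" "n < 2 * length Ls"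
  shows "affine_subspace n k (output_subspace n s)"
    and "1 / 12 * real d * real n powr (1 / (real d - 1)) \<le> real k"
    and "degree_on n (output_subspace n s) f \<le> d - 1"
proof -
  have Ls: "distinct Ls" "set Ls = {T. T \<subseteq> {1..k} \<and> card T \<le> d - 1}"
    and lin_indep: "lin_indep (B @ map v [1..<Suc k])" and F2: "v ` {1..k} \<subseteq> F2 n"
    and coef: "\<forall>T. T \<subseteq> {1..k} \<longrightarrow> card T = d \<longrightarrow> coefficient v T = 0"
    using gr[unfolded greedy_def] by - (elim conjE, assumption)+
  have "length Ls = card {T. T \<subseteq> {1..k} \<and> card T \<le> d - 1}"
    using distinct_card[OF Ls(1)] unfolding Ls(2) by simp
  then show "1 / 12 * real d * real n powr (1 / (real d - 1)) \<le> real k"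
    using n by (intro dimension_lower_bound[OF d n(1)]) simp
  have lin_indep': "lin_indep (map v [1..<Suc k])"
    using lin_indep F2.independent_mono[of "set (B @ map v [1..<Suc k])" "set (map v [1..<Suc k])"]
    unfolding lin_indep_def distinct_append set_append by blast
  have "set [1..<Suc k] = {1..k}" by auto
  then have inj: "inj_on v {1..k}" and ind: "F2.independent (v ` {1..k})"
    using lin_indep' unfolding lin_indep_def distinct_map set_map by simp_all
  have "out_block n s ` {1..s ''out'' 0} = v ` {1..k}" "out_block n s 0 = 0"
    using st by (simp_all add: stores_def)
  then have U: "output_subspace n s = F2.span (v ` {1..k})"
    by (simp add: output_subspace_def)
  show "degree_on n (output_subspace n s) f \<le> d - 1"
    unfolding U by (rule degree_on_span_le[OF lin_indep' F2]) (use coef in blast)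
  have "F2.dim (F2.span (v ` {1..k})) = k"
    using F2.dim_span_eq_card_independent[OF ind] card_image[OF inj] by simp
  moreover have "F2.span (v ` {1..k}) \<subseteq> F2 n"
    by (rule F2.span_minimal[OF F2 subspace_F2])
  ultimately show "affine_subspace n k (output_subspace n s)"
    unfolding U affine_subspace_def
    by (intro bexI[of _ 0] exI[of _ "F2.span (v ` {1..k})"]) (auto simp: F2.subspace_span F2_def)
qed

end

theorem theorem4p1:
  shows "\<exists>(P :: prog) (C :: nat) (e :: nat) (c :: real). c > 0 \<and>
    (\<forall>(n :: nat) (d :: nat) (p :: mlpoly) (f :: point \<Rightarrow> bit).
       d \<ge> 2 \<longrightarrow> real d \<le> log 2 (real n) / 3 \<longrightarrow>
       (\<forall>x\<in>F2 n. f x = mleval n p x) \<longrightarrow> mldegree n p = d \<longrightarrow>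
       (\<exists>q t s. run n f P (input_state n d) q t s \<and>
          q \<le> C * n ^ e \<and> t \<le> C * n ^ e \<and>
          (\<exists>k. affine_subspace n k (output_subspace n s) \<and>
               real k \<ge> c * real d * real n powr (1 / (real d - 1)) \<and>
               degree_on n (output_subspace n s) f \<le> d - 1)))"
proof (rule exI[of _ Main], rule exI[of _ 128000], rule exI[of _ 5], rule exI[of _ "1 / 12"],
    intro conjI allI impI)
  fix n d :: nat and p :: mlpoly and f :: "point \<Rightarrow> bit"
  assume d: "d \<ge> 2" and log: "real d \<le> log 2 (real n) / 3"
    and f: "\<forall>x\<in>F2 n. f x = mleval n p x" and p: "mldegree n p = d"
  interpret lowdeg_oracle n d f "mleval n p"
    using f d lowdeg_mleval[of n p] p by unfold_locales simp_all
  have "n \<noteq> 0"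
  proof
    assume "n = 0"
    \<comment> \<open>Here \<open>log 2 0\<close> evaluates to \<open>0\<close>, so the bound would
      force \<open>d = 0\<close>.\<close>
    then show False using log d by (simp add: log_def)
  qed
  have "real (3 * d) \<le> log 2 (real n)" using log by simp
  then have "2 powr real (3 * d) \<le> real n" using \<open>n \<noteq> 0\<close> by (simp add: le_log_iff)
  then have "real (2 ^ (3 * d)) \<le> real n" by (simp add: powr_realpow[symmetric])
  then have big: "2 ^ (3 * d) \<le> n" by (simp only: of_nat_le_iff)
  obtain q t s k v Ls B where run: "run n f Main (input_state n d) q t s" "t \<le> 4000 * (n + 1) ^ 5"
    and st: "stores n d k v Ls B s" "greedy k v Ls B" "n < 2 * length Ls"
    using halts_Main \<open>n \<noteq> 0\<close> unfolding halts_def by blast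
  \<comment> \<open>Passing from \<open>n + 1\<close> to \<open>2 * n\<close> turns
    \<open>4000\<close> into \<open>4000 * 2 ^ 5 = 128000\<close>.\<close>
  have "(n + 1) ^ 5 \<le> (2 * n) ^ 5" using \<open>n \<noteq> 0\<close> by (intro power_mono) auto
  then have t: "t \<le> 128000 * n ^ 5" using run(2) by (simp add: power_mult_distrib)
  then have "q \<le> 128000 * n ^ 5" using run_queries_le_time[OF run(1)] by simp
  with t run(1) output_correct[OF st(1,2) big st(3)]
  show "\<exists>q t s. run n f Main (input_state n d) q t s \<and>
          q \<le> 128000 * n ^ 5 \<and> t \<le> 128000 * n ^ 5 \<and>
          (\<exists>k. affine_subspace n k (output_subspace n s) \<and>
               real k \<ge> 1 / 12 * real d * real n powr (1 / (real d - 1)) \<and>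
               degree_on n (output_subspace n s) f \<le> d - 1)"
    by blast
qed simp

end
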